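(* Let $K=\mathbb Q(\zeta_7+\zeta_7^{-1})$ with ring of integers $\mathcal O_K$. Then the quadratic form $Q(x,y,z,w)=x^2+y^2+z^2+w^2+xy+xz+xw$ is universal over $\mathcal O_K$: every totally positive $\alpha\in\mathcal O_K$ equals $Q(x,y,z,w)$ for some $x,y,z,w\in\mathcal O_K$.
   Context: $\zeta_7$ is a primitive 7th root of unity; an element of $K$ is totally positive if all its real embeddings are positive. *)

theory Defs
  imports "HOL-Algebra.Algebraic_Closure_Type" "HOL-Algebra.Generated_Fields" Complex_Main
begin

definition primitive_root_of_unity :: "nat \<Rightarrow> 'a::field \<Rightarrow> bool" where
  "primitive_root_of_unity n z \<longleftrightarrow> z ^ n = 1 \<and> (\<forall>m. 0 < m \<and> m < n \<longrightarrow> z ^ m \<noteq> 1)"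

definition adjoin_rat :: "complex \<Rightarrow> complex set" where
  "adjoin_rat \<theta> = generate_field ring_of_type_algebra (insert \<theta> \<rat>)"

definition ring_of_integers :: "complex set \<Rightarrow> complex set" where
  "ring_of_integers K = {x \<in> K. algebraic_int x}"

(* A ring homomorphism from a field to the reals preserves 1, hence is injective.
   Only the values on K matter. *)
definition real_embeddings :: "complex set \<Rightarrow> (complex \<Rightarrow> real) set" where
  "real_embeddings K = ring_hom (ring_of_type_algebra\<lparr>carrier := K\<rparr>) ring_of_type_algebra"

definition totally_positive :: "complex set \<Rightarrow> complex \<Rightarrow> bool" where
  "totally_positive K a \<longleftrightarrow> a \<in> K \<and> (\<forall>\<sigma>\<in>real_embeddings K. \<sigma> a > 0)"

end

theory Submission
  imports Defs
begin

text \<open>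
  Write \<open>R = \<int>[\<theta>]\<close> with \<open>\<theta> = \<zeta> + \<zeta>\<^sup>-\<^sup>1\<close>, so that \<open>\<theta>\<^sup>3 + \<theta>\<^sup>2 - 2 \<theta> - 1 = 0\<close>. The form \<open>Q\<close> is the reduced norm of the
  Hurwitz order \<open>H\<close> extended to \<open>R\<close>, written in the basis \<open>(1 + i + j + k)/2, 1, i, j\<close>. Given a totally positive
  \<open>\<alpha>\<close>, choose a \<open>\<int>\<close>-basis \<open>e\<^sub>0, e\<^sub>1, e\<^sub>2\<close> of \<open>R\<close> with \<open>c\<^sub>i e\<^sub>i \<in> \<alpha> R\<close>, \<open>c\<^sub>2\<close> dividing \<open>c\<^sub>1\<close> dividing \<open>c\<^sub>0\<close> and
  \<open>c\<^sub>0 c\<^sub>1 c\<^sub>2 = N(\<alpha>)\<close>. Every positive integer is a norm from \<open>H\<close>, so there are \<open>x\<^sub>i \<in> H\<close> of norm \<open>c\<^sub>i\<close>, each a left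
  multiple of the next. The left \<open>H\<close>-module spanned by the \<open>x\<^sub>i e\<^sub>i\<close> has norms divisible by \<open>\<alpha>\<close>, and the positive Hermitian form
  \<open>Tr(y z\<^sup>* / \<alpha>)\<close> on it is \<open>H\<close>-valued of determinant 49. As \<open>H\<close> is Euclidean with constant 1/2, Hermite reduction
  gives \<open>y\<close> of norm \<open>\<alpha> m\<close> with \<open>0 < Tr(m) \<le> 7\<close>. The finitely many totally positive \<open>m\<close> of this kind are squares of units times
  1, 2 or \<open>2 - \<theta>\<close>, and elements of norm 2 or \<open>2 - \<theta>\<close> can be split off because every ideal of that norm
  is principal.
\<close>

section \<open>Cubic integers and Hurwitz quaternions\<close>

text \<open>\<open>Cub a b c\<close> stands for \<open>a + b \<theta> + c \<theta>\<^sup>2\<close>.\<close>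

datatype 'a cub = Cub (cf0: 'a) (cf1: 'a) (cf2: 'a)

lemma cub_eq_iff: "x = y \<longleftrightarrow> cf0 x = cf0 y \<and> cf1 x = cf1 y \<and> cf2 x = cf2 y"
  by (cases x; cases y) auto

instantiation cub :: (comm_ring_1) comm_ring_1
begin

definition "0 = Cub 0 0 0"
definition "1 = Cub 1 0 0"
definition "x + y = Cub (cf0 x + cf0 y) (cf1 x + cf1 y) (cf2 x + cf2 y)"
definition "x - y = Cub (cf0 x - cf0 y) (cf1 x - cf1 y) (cf2 x - cf2 y)"
definition "- x = Cub (- cf0 x) (- cf1 x) (- cf2 x)"
text \<open>Polynomial multiplication reduced by \<theta>^3 = 1 + 2 \<theta> - \<theta>^2 and
  \<theta>^4 = -1 - \<theta> + 3 \<theta>^2; \<open>a\<close> and \<open>b\<close> are the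
  coefficients of \<theta>^3 and \<theta>^4.\<close>

definition "x * y =
  (let a = cf1 x * cf2 y + cf2 x * cf1 y; b = cf2 x * cf2 y in
   Cub (cf0 x * cf0 y + a - b) (cf0 x * cf1 y + cf1 x * cf0 y + 2 * a - b)
     (cf0 x * cf2 y + cf1 x * cf1 y + cf2 x * cf0 y - a + 3 * b))"

instance
  by standard
    (simp_all add: zero_cub_def one_cub_def plus_cub_def minus_cub_def uminus_cub_def
      times_cub_def Let_def algebra_simps)

end

lemma cub_simps [simp]:
  "cf0 0 = 0" "cf1 0 = 0" "cf2 0 = 0" "cf0 1 = 1" "cf1 1 = 0" "cf2 1 = 0"
  "cf0 (x + y) = cf0 x + cf0 y" "cf1 (x + y) = cf1 x + cf1 y" "cf2 (x + y) = cf2 x + cf2 y"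
  "cf0 (x - y) = cf0 x - cf0 y" "cf1 (x - y) = cf1 x - cf1 y" "cf2 (x - y) = cf2 x - cf2 y"
  "cf0 (- x) = - cf0 x" "cf1 (- x) = - cf1 x" "cf2 (- x) = - cf2 x"
  by (simp_all add: zero_cub_def one_cub_def plus_cub_def minus_cub_def uminus_cub_def)

lemma cub_mult:
  "cf0 (x * y) = cf0 x * cf0 y + (cf1 x * cf2 y + cf2 x * cf1 y) - cf2 x * cf2 y"
  "cf1 (x * y) = cf0 x * cf1 y + cf1 x * cf0 y + 2 * (cf1 x * cf2 y + cf2 x * cf1 y) - cf2 x * cf2 y"
  "cf2 (x * y) = cf0 x * cf2 y + cf1 x * cf1 y + cf2 x * cf0 y
     - (cf1 x * cf2 y + cf2 x * cf1 y) + 3 * (cf2 x * cf2 y)"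
  by (simp_all add: times_cub_def Let_def)

lemma of_int_cub: "(of_int n :: 'a::comm_ring_1 cub) = Cub (of_int n) 0 0"
proof -
  have *: "(of_nat k :: 'a cub) = Cub (of_nat k) 0 0" for k
    by (induction k) (simp_all add: cub_eq_iff)
  show ?thesis
    by (cases n rule: int_cases2) (simp_all add: * cub_eq_iff)
qed

lemma cub_of_int [simp]: "cf0 (of_int n) = of_int n" "cf1 (of_int n) = 0" "cf2 (of_int n) = 0"
  by (simp_all add: of_int_cub)

lemma cub_numeral [simp]:
  "cf0 (numeral n :: 'a::comm_ring_1 cub) = numeral n" "cf1 (numeral n :: 'a cub) = 0"
  "cf2 (numeral n :: 'a cub) = 0"
proof -
  have "(numeral n :: 'a cub) = Cub (numeral n) 0 0"
    using of_int_cub[of "numeral n"] by (simp only: of_int_numeral)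
  then show "cf0 (numeral n :: 'a cub) = numeral n" "cf1 (numeral n :: 'a cub) = 0"
    "cf2 (numeral n :: 'a cub) = 0"
    by (simp_all only: cub.sel)
qed

section \<open>Evaluation at roots of the cubic; norm, adjugate and trace\<close>

definition ev :: "'a::comm_ring_1 \<Rightarrow> 'a cub \<Rightarrow> 'a" where
  "ev t x = cf0 x + cf1 x * t + cf2 x * t\<^sup>2"

definition is_root :: "'a::comm_ring_1 \<Rightarrow> bool" where
  "is_root t \<longleftrightarrow> t ^ 3 = 1 + 2 * t - t\<^sup>2"

lemma ev_add [simp]: "ev t (x + y) = ev t x + ev t y"
  and ev_diff [simp]: "ev t (x - y) = ev t x - ev t y"
  and ev_uminus [simp]: "ev t (- x) = - ev t x"
  and ev_0 [simp]: "ev t 0 = 0"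
  and ev_1 [simp]: "ev t 1 = 1"
  and ev_of_int [simp]: "ev t (of_int n) = of_int n"
  and ev_numeral [simp]: "ev t (numeral m) = numeral m"
  by (simp_all add: ev_def algebra_simps)

lemma ev_mult [simp]:
  assumes "is_root t"
  shows "ev t (x * y) = ev t x * ev t y"
proof -
  have t3: "t ^ 3 = 1 + 2 * t - t\<^sup>2" using assms by (simp add: is_root_def)
  obtain a b c where x: "x = Cub a b c" by (cases x)
  obtain a' b' c' where y: "y = Cub a' b' c'" by (cases y)
  \<comment> \<open>Before reduction the product is the polynomial product, so the difference is a
    multiple of the cubic; the last factor is the quotient.\<close>
  have "ev t (x * y) - ev t x * ev t y =
    (1 + 2 * t - t\<^sup>2 - t ^ 3) * (b * c' + c * b' + c * c' * (t - 1))"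
    by (simp add: ev_def cub_mult x y algebra_simps power2_eq_square power3_eq_cube)
  then show ?thesis by (simp add: t3)
qed

text \<open>The determinant of multiplication by \<open>x\<close> (compare
  \<open>cnorm_eq_cdet\<close>); \<open>cadj\<close> below is the product of the two other
  conjugates (\<open>cadj_eq\<close>).\<close>

definition cnorm :: "'a::comm_ring_1 cub \<Rightarrow> 'a" where
  "cnorm x = (let a = cf0 x; b = cf1 x; c = cf2 x in
     a ^ 3 + b ^ 3 + c ^ 3 - a\<^sup>2 * b + 5 * a\<^sup>2 * c - 2 * a * b\<^sup>2 + 6 * a * c\<^sup>2
     - b\<^sup>2 * c - 2 * b * c\<^sup>2 - a * b * c)"

definition cadj :: "'a::comm_ring_1 cub \<Rightarrow> 'a cub" where
  "cadj x = (let a = cf0 x; b = cf1 x; c = cf2 x in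
     Cub (a\<^sup>2 - 2 * b\<^sup>2 + 5 * c\<^sup>2 - a * b + 5 * a * c + b * c)
         (b\<^sup>2 - c\<^sup>2 - a * b - b * c)
         (b\<^sup>2 - 2 * c\<^sup>2 - a * c - b * c))"

text \<open>The coefficients are the traces 3, -1, 5 of 1, \<theta>, \<theta>^2.\<close>

definition ctr :: "'a::comm_ring_1 cub \<Rightarrow> 'a" where
  "ctr x = 3 * cf0 x - cf1 x + 5 * cf2 x"

lemma cub_adj: "x * cadj x = Cub (cnorm x) 0 0"
  by (cases x) (simp add: cub_eq_iff cub_mult cadj_def cnorm_def Let_def
      algebra_simps power2_eq_square power3_eq_cube)

text \<open>\<open>HQ p q r s\<close> stands for \<open>p + q i + r j + s (1 + i + j + k)/2\<close>.\<close>

datatype 'a hq = HQ (hq1: 'a) (hqi: 'a) (hqj: 'a) (hqw: 'a)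

lemma hq_eq_iff: "x = y \<longleftrightarrow> hq1 x = hq1 y \<and> hqi x = hqi y \<and> hqj x = hqj y \<and> hqw x = hqw y"
  by (cases x; cases y) auto

instantiation hq :: (comm_ring_1) ring_1
begin

definition "0 = HQ 0 0 0 0"
definition "1 = HQ 1 0 0 0"
definition "x + y = HQ (hq1 x + hq1 y) (hqi x + hqi y) (hqj x + hqj y) (hqw x + hqw y)"
definition "x - y = HQ (hq1 x - hq1 y) (hqi x - hqi y) (hqj x - hqj y) (hqw x - hqw y)"
definition "- x = HQ (- hq1 x) (- hqi x) (- hqj x) (- hqw x)"
definition "x * y =
  (let p = hq1 x; q = hqi x; r = hqj x; s = hqw x; p' = hq1 y; q' = hqi y; r' = hqj y; s' = hqw y in
   HQ (p * p' - q * q' - q * r' - q * s' + r * q' - r * r' - s * r' - s * s')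
      (p * q' + q * p' - q * r' + r * q' + r * s' + s * q' - s * r')
      (p * r' - q * r' - q * s' + r * p' + r * q' + r * s' + s * q')
      (p * s' + 2 * (q * r') + q * s' - 2 * (r * q') - r * s' + s * p' - s * q' + s * r' + s * s'))"

instance
  by standard
    (simp_all add: zero_hq_def one_hq_def plus_hq_def minus_hq_def uminus_hq_def
      times_hq_def Let_def algebra_simps)

end

lemma hq_simps [simp]:
  "hq1 0 = 0" "hqi 0 = 0" "hqj 0 = 0" "hqw 0 = 0"
  "hq1 1 = 1" "hqi 1 = 0" "hqj 1 = 0" "hqw 1 = 0"
  "hq1 (x + y) = hq1 x + hq1 y" "hqi (x + y) = hqi x + hqi y"
  "hqj (x + y) = hqj x + hqj y" "hqw (x + y) = hqw x + hqw y"
  "hq1 (x - y) = hq1 x - hq1 y" "hqi (x - y) = hqi x - hqi y"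
  "hqj (x - y) = hqj x - hqj y" "hqw (x - y) = hqw x - hqw y"
  "hq1 (- x) = - hq1 x" "hqi (- x) = - hqi x" "hqj (- x) = - hqj x" "hqw (- x) = - hqw x"
  by (simp_all add: zero_hq_def one_hq_def plus_hq_def minus_hq_def uminus_hq_def)

lemma hq_mult:
  "hq1 (x * y) = hq1 x * hq1 y - hqi x * hqi y - hqi x * hqj y - hqi x * hqw y
     + hqj x * hqi y - hqj x * hqj y - hqw x * hqj y - hqw x * hqw y"
  "hqi (x * y) = hq1 x * hqi y + hqi x * hq1 y - hqi x * hqj y + hqj x * hqi y
     + hqj x * hqw y + hqw x * hqi y - hqw x * hqj y"
  "hqj (x * y) = hq1 x * hqj y - hqi x * hqj y - hqi x * hqw y + hqj x * hq1 y
     + hqj x * hqi y + hqj x * hqw y + hqw x * hqi y"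
  "hqw (x * y) = hq1 x * hqw y + 2 * (hqi x * hqj y) + hqi x * hqw y - 2 * (hqj x * hqi y)
     - hqj x * hqw y + hqw x * hq1 y - hqw x * hqi y + hqw x * hqj y + hqw x * hqw y"
  by (simp_all add: times_hq_def Let_def)

text \<open>The conjugate of \<omega> = (1 + i + j + k)/2 is 1 - \<omega>, which moves
  \<open>hqw x\<close> into the coefficient of 1.\<close>

definition hconj :: "'a::comm_ring_1 hq \<Rightarrow> 'a hq" where
  "hconj x = HQ (hq1 x + hqw x) (- hqi x) (- hqj x) (- hqw x)"

definition hnorm :: "'a::comm_ring_1 hq \<Rightarrow> 'a" where
  "hnorm x = (hq1 x)\<^sup>2 + (hqi x)\<^sup>2 + (hqj x)\<^sup>2 + (hqw x)\<^sup>2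
     + hqw x * (hq1 x + hqi x + hqj x)"

definition htr :: "'a::comm_ring_1 hq \<Rightarrow> 'a" where
  "htr x = 2 * hq1 x + hqw x"

definition scal :: "'a::comm_ring_1 \<Rightarrow> 'a hq" where
  "scal a = HQ a 0 0 0"

lemma hq_conj [simp]:
  "hq1 (hconj x) = hq1 x + hqw x" "hqi (hconj x) = - hqi x"
  "hqj (hconj x) = - hqj x" "hqw (hconj x) = - hqw x"
  by (simp_all add: hconj_def)

lemma hq_scal [simp]: "hq1 (scal a) = a" "hqi (scal a) = 0" "hqj (scal a) = 0" "hqw (scal a) = 0"
  by (simp_all add: scal_def)

lemma scal_simps [simp]:
  "scal 0 = 0" "scal 1 = 1" "scal (a + b) = scal a + scal b" "scal (a - b) = scal a - scal b"
  "scal a = scal b \<longleftrightarrow> a = b"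
  by (simp_all add: hq_eq_iff hq_mult)

lemma scal_mult: "scal (a * b) = scal a * scal b"
  by (simp add: hq_eq_iff hq_mult)

lemma scal_commute: "x * scal a = scal a * x"
  by (simp add: hq_eq_iff hq_mult)

lemma scal_left_commute: "x * (scal a * y) = scal a * (x * y)"
  by (metis scal_commute mult.assoc)

lemma hq_scal_mult [simp]:
  "hq1 (scal a * x) = a * hq1 x" "hqi (scal a * x) = a * hqi x"
  "hqj (scal a * x) = a * hqj x" "hqw (scal a * x) = a * hqw x"
  by (simp_all add: hq_mult)

lemma hconj_simps [simp]:
  "hconj 0 = 0" "hconj (x + y) = hconj x + hconj y" "hconj (x - y) = hconj x - hconj y"
  "hconj (scal a) = scal a" "hconj (hconj x) = x"
  by (simp_all add: hq_eq_iff)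

lemma hconj_mult [simp]: "hconj (x * y) = hconj y * hconj x"
  by (simp add: hq_eq_iff hq_mult algebra_simps)

lemma hconj_right: "x * hconj x = scal (hnorm x)"
  by (simp add: hq_eq_iff hq_mult hnorm_def algebra_simps power2_eq_square)

lemma hnorm_conj [simp]: "hnorm (hconj x) = hnorm x"
  by (simp add: hnorm_def algebra_simps power2_eq_square)

lemma hconj_left: "hconj x * x = scal (hnorm x)"
  using hconj_right[of "hconj x"] by simp

lemma hnorm_scal [simp]: "hnorm (scal a) = a\<^sup>2"
  by (simp add: hnorm_def)

lemma hnorm_mult [simp]: "hnorm (x * y) = hnorm x * hnorm y"
proof -
  have "scal (hnorm (x * y)) = x * (y * hconj y) * hconj x"
    by (simp add: hconj_right[symmetric] mult.assoc)
  also have "\<dots> = scal (hnorm y) * (x * hconj x)"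
    by (simp only: hconj_right scal_left_commute mult.assoc)
  also have "\<dots> = scal (hnorm x * hnorm y)"
    by (simp add: hconj_right mult.commute flip: scal_mult)
  finally show ?thesis by simp
qed

lemma htr_mult_commute: "htr (x * y) = htr (y * x)"
  by (simp add: htr_def hq_mult algebra_simps)

lemma htr_simps [simp]:
  "htr (hconj x) = htr x" "htr (x + y) = htr x + htr y" "htr (x - y) = htr x - htr y"
  "htr (scal a * x) = a * htr x"
  by (simp_all add: htr_def algebra_simps)

lemma hnorm_diff: "hnorm (x - y) = hnorm x + hnorm y - htr (x * hconj y)"
  by (simp add: hnorm_def htr_def hq_mult algebra_simps power2_eq_square)

section \<open>Lagrange's four-square theorem for Hurwitz quaternions\<close>

text \<open>The four squared terms are the coordinates of 2 x with respect to 1, i, j, k.\<close>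

lemma four_hnorm:
  fixes x :: "'a::comm_ring_1 hq"
  shows "4 * hnorm x = (2 * hq1 x + hqw x)\<^sup>2 + (2 * hqi x + hqw x)\<^sup>2
    + (2 * hqj x + hqw x)\<^sup>2 + (hqw x)\<^sup>2"
  by (simp add: hnorm_def algebra_simps power2_eq_square)

lemma hnorm_nonneg: "hnorm (x :: int hq) \<ge> 0"
  using four_hnorm[of x] by (smt (verit) zero_le_power2)

lemma hnorm_eq_0_iff: "hnorm (x :: int hq) = 0 \<longleftrightarrow> x = 0"
proof
  assume "hnorm x = 0"
  then have "(2 * hq1 x + hqw x)\<^sup>2 + (2 * hqi x + hqw x)\<^sup>2
    + (2 * hqj x + hqw x)\<^sup>2 + (hqw x)\<^sup>2 = 0"
    using four_hnorm[of x] by simp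
  then have "(2 * hq1 x + hqw x)\<^sup>2 = 0 \<and> (2 * hqi x + hqw x)\<^sup>2 = 0
    \<and> (2 * hqj x + hqw x)\<^sup>2 = 0 \<and> (hqw x)\<^sup>2 = 0"
    by (smt (verit) zero_le_power2)
  then show "x = 0" by (simp add: hq_eq_iff)
qed (simp add: hnorm_def)

text \<open>If a real number has distance \<open>\<delta>\<close> from \<open>\<int>\<close>, then it has distance \<open>1/2 - \<delta>\<close> from \<open>\<int> + 1/2\<close>,
  and \<open>\<delta>\<^sup>2 + (1/2 - \<delta>)\<^sup>2 \<le> 1/4\<close>. Here the number is \<open>a / (2 n)\<close>. Summing over four coordinates shows that
  \<open>\<int>\<^sup>4\<close> or \<open>(\<int> + 1/2)\<^sup>4\<close> has a point at squared distance at most 1/2.\<close>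

lemma nearest_int_pair:
  fixes a n :: int
  assumes "n > 0"
  shows "\<exists>k l. (a - 2 * n * k)\<^sup>2 + (a - n - 2 * n * l)\<^sup>2 \<le> n\<^sup>2"
proof -
  define m where "m = a div n"
  define d where "d = a - n * m"
  have d: "0 \<le> d" "d \<le> n" using assms
    by (simp_all add: d_def m_def minus_mult_div_eq_mod less_imp_le)
  have dd: "d\<^sup>2 + (d - n)\<^sup>2 \<le> n\<^sup>2"
  proof -
    have "d * (n - d) \<ge> 0" using d by simp
    then show ?thesis by (simp add: power2_eq_square algebra_simps)
  qed
  show ?thesis
  proof (cases "even m")
    case True
    then obtain k where "m = 2 * k" by blast
    then have "a - 2 * n * k = d" "a - n - 2 * n * k = d - n"
      by (simp_all add: d_def)
    then show ?thesis using dd by metis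
  next
    case False
    then obtain k where "m = 2 * k + 1" by (blast elim: oddE)
    then have "a - 2 * n * (k + 1) = d - n" "a - n - 2 * n * k = d"
      by (simp_all add: d_def algebra_simps)
    then show ?thesis using dd by (metis add.commute)
  qed
qed

lemma hq_division:
  fixes x :: "int hq" and n :: int
  assumes "n > 0"
  shows "\<exists>k. 2 * hnorm (x - scal n * k) \<le> n\<^sup>2"
proof -
  define a b c e where "a = 2 * hq1 x + hqw x" and "b = 2 * hqi x + hqw x"
    and "c = 2 * hqj x + hqw x" and "e = hqw x"
  obtain ka la where a: "(a - 2 * n * ka)\<^sup>2 + (a - n - 2 * n * la)\<^sup>2 \<le> n\<^sup>2"
    using nearest_int_pair[OF assms] by blast
  obtain kb lb where b: "(b - 2 * n * kb)\<^sup>2 + (b - n - 2 * n * lb)\<^sup>2 \<le> n\<^sup>2"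
    using nearest_int_pair[OF assms] by blast
  obtain kc lc where c: "(c - 2 * n * kc)\<^sup>2 + (c - n - 2 * n * lc)\<^sup>2 \<le> n\<^sup>2"
    using nearest_int_pair[OF assms] by blast
  obtain ke le where e: "(e - 2 * n * ke)\<^sup>2 + (e - n - 2 * n * le)\<^sup>2 \<le> n\<^sup>2"
    using nearest_int_pair[OF assms] by blast
  \<comment> \<open>In coordinates 1, i, j, k these are the integral point (ka, kb, kc, ke) and the
    half-integral point (la + 1/2, lb + 1/2, lc + 1/2, le + 1/2). The two values of 4
    \<open>hnorm\<close> add up to at most 4 n^2, so one is at most 2 n^2.\<close>
  define k where "k = HQ (ka - ke) (kb - ke) (kc - ke) (2 * ke)"
  define l where "l = HQ (la - le) (lb - le) (lc - le) (2 * le + 1)"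
  have "4 * hnorm (x - scal n * k) = (a - 2 * n * ka)\<^sup>2 + (b - 2 * n * kb)\<^sup>2
      + (c - 2 * n * kc)\<^sup>2 + (e - 2 * n * ke)\<^sup>2"
    unfolding four_hnorm by (simp add: k_def a_def b_def c_def e_def algebra_simps)
  moreover have "4 * hnorm (x - scal n * l) = (a - n - 2 * n * la)\<^sup>2 + (b - n - 2 * n * lb)\<^sup>2
      + (c - n - 2 * n * lc)\<^sup>2 + (e - n - 2 * n * le)\<^sup>2"
    unfolding four_hnorm by (simp add: l_def a_def b_def c_def e_def algebra_simps)
  ultimately have "2 * hnorm (x - scal n * k) \<le> n\<^sup>2 \<or> 2 * hnorm (x - scal n * l) \<le> n\<^sup>2"
    using a b c e by linarith
  then show ?thesis by blast
qed

text \<open>Pigeonhole: for 0 \<le> a, b \<le> (p - 1)/2 the residues of a^2 and of -1 - b^2 form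
  two sets of size (p + 1)/2 each, so they meet. The size bounds make the cofactor of
  \<open>p\<close> smaller than \<open>p\<close> in \<open>hnorm_prime\<close>.\<close>

lemma sum_two_squares_mod_prime:
  fixes p :: int
  assumes "prime p" "odd p"
  shows "\<exists>a b. p dvd a\<^sup>2 + b\<^sup>2 + 1 \<and> 2 * \<bar>a\<bar> < p \<and> 2 * \<bar>b\<bar> < p"
proof -
  have p: "p > 2" using assms by (metis even_numeral order_le_neq_trans prime_ge_2_int)
  define H where "H = {0..(p - 1) div 2}"
  define A where "A = (\<lambda>a. a\<^sup>2 mod p) ` H"
  define B where "B = (\<lambda>b. (- 1 - b\<^sup>2) mod p) ` H"
  have H: "card H = nat ((p + 1) div 2)" "finite H"
    using p assms(2) by (auto simp: H_def elim!: oddE)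
  have inj: "a = b" if "a \<in> H" "b \<in> H" "p dvd a\<^sup>2 - b\<^sup>2" for a b
  proof -
    have "p dvd (a - b) * (a + b)" using that(3) by (simp add: algebra_simps power2_eq_square)
    then have "p dvd a - b \<or> p dvd a + b" using assms(1) by (simp add: prime_dvd_mult_iff)
    moreover have "\<bar>a - b\<bar> < p" "a + b < p" "0 \<le> a" "0 \<le> b"
      using that p assms(2) by (auto simp: H_def abs_less_iff elim!: oddE)
    ultimately show ?thesis
      by (smt (verit) zdvd_imp_le dvd_minus_iff zdvd_not_zless)
  qed
  have "card A = card H" unfolding A_def
    by (rule card_image) (auto intro!: inj_onI inj simp: mod_eq_dvd_iff)
  moreover have "card B = card H" unfolding B_def
  proof (rule card_image, rule inj_onI)
    fix a b assume "a \<in> H" "b \<in> H" "(- 1 - a\<^sup>2) mod p = (- 1 - b\<^sup>2) mod p"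
    then have "p dvd (- 1 - a\<^sup>2) - (- 1 - b\<^sup>2)" by (simp only: mod_eq_dvd_iff)
    then have "p dvd b\<^sup>2 - a\<^sup>2" by simp
    then show "a = b" using inj[of b a] \<open>a \<in> H\<close> \<open>b \<in> H\<close> by simp
  qed
  moreover have "card (A \<union> B) \<le> nat p"
  proof -
    have "A \<union> B \<subseteq> {0..<p}" using p by (auto simp: A_def B_def)
    then show ?thesis using card_mono[of "{0..<p}" "A \<union> B"] by simp
  qed
  moreover have "finite A" "finite B" using H by (simp_all add: A_def B_def)
  moreover have "2 * nat ((p + 1) div 2) > nat p" using p assms(2) by (auto elim!: oddE)
  ultimately have "A \<inter> B \<noteq> {}"
    using card_Un_disjoint[of A B] H by fastforce
  then obtain a b where ab: "a \<in> H" "b \<in> H" "a\<^sup>2 mod p = (- 1 - b\<^sup>2) mod p"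
    by (auto simp: A_def B_def)
  then have "p dvd a\<^sup>2 - (- 1 - b\<^sup>2)" by (simp only: mod_eq_dvd_iff)
  then have "p dvd a\<^sup>2 + b\<^sup>2 + 1" by (simp add: algebra_simps)
  moreover have "2 * \<bar>a\<bar> < p" "2 * \<bar>b\<bar> < p"
    using ab p assms(2) by (auto simp: H_def elim!: oddE)
  ultimately show ?thesis by blast
qed

lemma scal_dvd_iff:
  fixes x :: "'a::comm_ring_1 hq"
  shows "(\<exists>y. x = scal n * y) \<longleftrightarrow> n dvd hq1 x \<and> n dvd hqi x \<and> n dvd hqj x \<and> n dvd hqw x"
proof
  assume "n dvd hq1 x \<and> n dvd hqi x \<and> n dvd hqj x \<and> n dvd hqw x"
  then obtain a b c d where "hq1 x = n * a" "hqi x = n * b" "hqj x = n * c" "hqw x = n * d"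
    by (auto elim!: dvdE)
  then have "x = scal n * HQ a b c d" by (simp add: hq_eq_iff)
  then show "\<exists>y. x = scal n * y" by blast
qed auto

text \<open>Lagrange's descent. Reduce \<open>x\<close> modulo \<open>m\<close> to \<open>y\<close>
  of norm m m' with 2 m' \<le> m; then x times the conjugate of y is divisible by \<open>m\<close>,
  and the quotient has norm m' p.\<close>

lemma hnorm_descent:
  fixes p :: int
  assumes "prime p" "0 < m" "m < p" "hnorm x = m * p"
  shows "\<exists>y :: int hq. hnorm y = p"
  using assms(2-)
proof (induction "nat m" arbitrary: m x rule: less_induct)
  case less
  show ?case
  proof (cases "m = 1")
    case True
    then show ?thesis using less.prems by auto
  next
    case False
    obtain k where k: "2 * hnorm (x - scal m * k) \<le> m\<^sup>2"
      using hq_division less.prems(1) by blast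
    define y where "y = x - scal m * k"
    have "x * hconj y = scal (m * p) - x * hconj k * scal m"
      by (simp add: y_def algebra_simps hconj_right less.prems)
    then have 1: "x * hconj y = scal m * (scal p - x * hconj k)"
      by (simp add: algebra_simps scal_left_commute scal_commute[of "hconj k"] scal_mult)
    define z where "z = scal p - x * hconj k"
    have ny: "hnorm y = m * p + m\<^sup>2 * hnorm k - m * htr (x * hconj k)"
      by (simp add: y_def hnorm_diff less.prems mult.assoc scal_commute[of "hconj k"] scal_left_commute)
    then have "m dvd hnorm y" by (simp add: power2_eq_square)
    then obtain m' where m': "hnorm y = m * m'" by blast
    have "m\<^sup>2 * hnorm z = hnorm (x * hconj y)" by (simp add: 1 z_def)
    also have "\<dots> = m\<^sup>2 * (m' * p)"
      by (simp add: less.prems m' power2_eq_square)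
    finally have z: "hnorm z = m' * p" using less.prems by simp
    have "m * (2 * m') \<le> m * m" using k by (simp add: y_def[symmetric] m' power2_eq_square)
    then have "2 * m' \<le> m" using less.prems by simp
    moreover have "m' \<ge> 0" using m' hnorm_nonneg[of y] less.prems by (simp add: zero_le_mult_iff)
    moreover have "m' \<noteq> 0"
    proof
      assume "m' = 0"
      then have "y = 0" using m' by (simp add: hnorm_eq_0_iff)
      then have "x = scal m * k" by (simp add: y_def)
      then have "m * p = m * (m * hnorm k)" using less.prems by (simp add: power2_eq_square)
      then have "m dvd p" using less.prems by simp
      then show False using assms(1) less.prems False
        by (metis abs_of_pos zdvd_not_zless prime_int_iff less_irrefl order_less_le)
    qed
    ultimately show ?thesis using less.hyps[of m' z] z less.prems by force
  qed
qed

lemma hnorm_prime: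
  fixes p :: int
  assumes "prime p"
  shows "\<exists>y :: int hq. hnorm y = p"
proof (cases "odd p")
  case True
  obtain a b where ab: "p dvd a\<^sup>2 + b\<^sup>2 + 1" "2 * \<bar>a\<bar> < p" "2 * \<bar>b\<bar> < p"
    using sum_two_squares_mod_prime[OF assms True] by blast
  obtain m where m: "a\<^sup>2 + b\<^sup>2 + 1 = p * m" using ab by blast
  have p: "p > 2" using assms True by (metis even_numeral order_le_neq_trans prime_ge_2_int)
  have "(2 * \<bar>a\<bar>)\<^sup>2 \<le> (p - 1)\<^sup>2" "(2 * \<bar>b\<bar>)\<^sup>2 \<le> (p - 1)\<^sup>2"
    by (rule power_mono; use ab in simp)+
  then have "4 * (p * m) \<le> 2 * (p - 1)\<^sup>2 + 4" using m[symmetric] by (simp add: power_mult_distrib)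
  also have "\<dots> < 4 * (p * p)" 
  proof -
    have "2 * (p - 1)\<^sup>2 + 4 = 2 * (p * p) - 4 * p + 6"
      by (simp add: power2_eq_square algebra_simps)
    moreover have "p * p > 0" using p by simp
    ultimately show ?thesis using p by linarith
  qed
  finally have "m < p" using p by simp
  moreover have "m > 0"
  proof -
    have "p * m > 0" using m by (metis add_nonneg_pos add_nonneg_nonneg zero_le_power2 zero_less_one)
    then show ?thesis using p by (simp add: zero_less_mult_iff)
  qed
  moreover have "hnorm (HQ a b 1 0) = m * p" using m by (simp add: hnorm_def mult.commute)
  ultimately show ?thesis using hnorm_descent[OF assms] by blast
next
  case False
  then have "p = 2" using assms by (metis primes_dvd_imp_eq two_is_prime_nat prime_int_numeral_eq)
  then have "hnorm (HQ 1 1 0 0) = p" by (simp add: hnorm_def)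
  then show ?thesis by blast
qed

lemma hnorm_represents:
  fixes n :: int
  assumes "n > 0"
  shows "\<exists>y :: int hq. hnorm y = n"
proof -
  have "\<exists>y :: int hq. hnorm y = int k" if "k > 0" for k
    using that
  proof (induction k rule: prime_divisors_induct)
    case (factor p k)
    then obtain y :: "int hq" where "hnorm y = int k" by auto
    moreover obtain z :: "int hq" where "hnorm z = int p" using hnorm_prime factor by (metis prime_nat_int_transfer)
    ultimately have "hnorm (z * y) = int (p * k)" by simp
    then show ?case by blast
  qed (auto intro!: exI[of _ 1] simp: hnorm_def)
  from this[of "nat n"] show ?thesis using assms by simp
qed

section \<open>Reduction of ternary Hermitian forms over the Hurwitz quaternions\<close>

text \<open>The Moore determinant of the Hermitian matrix with diagonal \<open>a, b, c\<close> and entries \<open>u, v, w\<close> in the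
  positions 12, 23, 13.\<close>

definition hdisc :: "int \<Rightarrow> int \<Rightarrow> int \<Rightarrow> int hq \<Rightarrow> int hq \<Rightarrow> int hq \<Rightarrow> int" where
  "hdisc a b c u v w =
     a * b * c + htr (u * v * hconj w) - a * hnorm v - b * hnorm w - c * hnorm u"

text \<open>Sylvester's identity: after projecting away the first basis vector, a binary Hermitian
  form with diagonal d = a b - N(u), e = a c - N(w) and off-diagonal entry P remains, whose
  determinant is a times \<open>hdisc\<close>. It allows the ternary case to be handled by binary
  arguments.\<close>

lemma hdisc_sylvester:
  "a * hdisc a b c u v w
   = (a * b - hnorm u) * (a * c - hnorm w) - hnorm (scal a * v - hconj u * w)"
proof -
  have "htr (u * v * hconj w) = htr (v * (hconj w * u))"
    by (metis htr_mult_commute mult.assoc)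
  then have "hnorm (scal a * v - hconj u * w)
    = a\<^sup>2 * hnorm v + hnorm u * hnorm w - a * htr (u * v * hconj w)"
    by (simp add: hnorm_diff mult.assoc)
  then show ?thesis
    by (simp add: hdisc_def algebra_simps power2_eq_square)
qed

lemma hdisc_swap12: "hdisc b a c (hconj u) w v = hdisc a b c u v w"
proof -
  have "hconj (hconj u * w * hconj v) = v * hconj w * u"
    by (simp add: mult.assoc)
  then have "htr (hconj u * w * hconj v) = htr (u * v * hconj w)"
    using htr_simps(1)[of "hconj u * w * hconj v"] htr_mult_commute[of "v * hconj w" u]
    by (simp only: mult.assoc)
  then show ?thesis by (simp add: hdisc_def algebra_simps)
qed

lemma hdisc_swap23: "hdisc a c b w (hconj v) u = hdisc a b c u v w"
proof -
  have "hconj (w * hconj v * hconj u) = u * v * hconj w"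
    by (simp add: mult.assoc)
  then have "htr (w * hconj v * hconj u) = htr (u * v * hconj w)"
    using htr_simps(1)[of "w * hconj v * hconj u"] by simp
  then show ?thesis by (simp add: hdisc_def algebra_simps)
qed

text \<open>Replacing b2 by b2 - k b1 changes neither d, e nor P in
  \<open>hdisc_sylvester\<close>.\<close>

lemma hdisc_shear12:
  assumes "a \<noteq> 0"
  shows "hdisc a (b - htr (k * u) + a * hnorm k) c (u - scal a * hconj k) (v - k * w) w
    = hdisc a b c u v w"
proof -
  have 1: "a * (b - htr (k * u) + a * hnorm k) - hnorm (u - scal a * hconj k) = a * b - hnorm u"
    using htr_mult_commute[of k u]
    by (simp add: hnorm_diff algebra_simps power2_eq_square scal_commute[of k] scal_left_commute)
  have 2: "scal a * (v - k * w) - hconj (u - scal a * hconj k) * w = scal a * v - hconj u * w"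
    by (simp add: algebra_simps scal_commute[of k] scal_left_commute)
  have "a * hdisc a (b - htr (k * u) + a * hnorm k) c (u - scal a * hconj k) (v - k * w) w
    = a * hdisc a b c u v w"
    unfolding hdisc_sylvester 1 2 ..
  then show ?thesis using assms by simp
qed

text \<open>Replacing b3 by b3 - k b2 acts on the projected binary form (d, P, e) of
  \<open>hdisc_sylvester\<close> as a shear, which preserves d e - N(P).\<close>

lemma hdisc_shear23:
  assumes "a \<noteq> 0"
  shows "hdisc a b (c - htr (k * v) + b * hnorm k) u (v - scal b * hconj k) (w - u * hconj k)
    = hdisc a b c u v w"
proof -
  define d where "d = a * b - hnorm u"
  define P where "P = scal a * v - hconj u * w"
  have P': "scal a * (v - scal b * hconj k) - hconj u * (w - u * hconj k) = P - scal d * hconj k"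
    by (simp add: P_def d_def algebra_simps scal_mult)
      (simp add: mult.assoc[symmetric] hconj_left)
  have "htr (w * hconj (u * hconj k)) = htr (k * (hconj u * w))"
    using htr_mult_commute[of w "k * hconj u"] by (simp add: mult.assoc)
  then have e': "a * (c - htr (k * v) + b * hnorm k) - hnorm (w - u * hconj k)
      = a * c - hnorm w - htr (k * P) + d * hnorm k"
    by (simp add: hnorm_diff P_def d_def algebra_simps scal_left_commute)
  have nP: "hnorm (P - scal d * hconj k) = hnorm P + d\<^sup>2 * hnorm k - d * htr (k * P)"
    using htr_mult_commute[of k P]
    by (simp add: hnorm_diff scal_commute[of k] scal_left_commute)
  have "a * hdisc a b (c - htr (k * v) + b * hnorm k) u (v - scal b * hconj k) (w - u * hconj k)
    = a * hdisc a b c u v w"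
    unfolding hdisc_sylvester P' e' nP unfolding d_def[symmetric] P_def[symmetric]
    by (simp add: algebra_simps power2_eq_square)
  then show ?thesis using assms by simp
qed

section \<open>The reduction algorithm on abstract Hermitian lattices\<close>

lemma hq_plus_conj: "x + hconj x = scal (htr x)"
  by (simp add: hq_eq_iff htr_def)

text \<open>Shears x - k y are the only lattice operation axiomatised, since the reduction uses just
  shears and swaps of basis vectors.\<close>

locale hermitian_lattice =
  fixes S :: "'v::ab_group_add set"
    and act :: "int hq \<Rightarrow> 'v \<Rightarrow> 'v"
    and h :: "'v \<Rightarrow> 'v \<Rightarrow> int hq"
  assumes diff_act: "x \<in> S \<Longrightarrow> y \<in> S \<Longrightarrow> x - act k y \<in> S"
    and h_left: "x \<in> S \<Longrightarrow> y \<in> S \<Longrightarrow> z \<in> S \<Longrightarrow> h (x - act k y) z = h x z - k * h y z"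
    and h_conj: "x \<in> S \<Longrightarrow> y \<in> S \<Longrightarrow> h y x = hconj (h x y)"
begin

lemma h_right:
  assumes "x \<in> S" "y \<in> S" "z \<in> S"
  shows "h z (x - act k y) = h z x - h z y * hconj k"
  using assms h_left[of x y z k] h_conj[of _ z] diff_act by simp

lemma h_shear:
  assumes "x \<in> S" "y \<in> S" "h x x = scal b" "h y y = scal a"
  shows "h (y - act k x) (y - act k x) = scal (a - htr (k * h x y) + b * hnorm k)"
proof -
  have "h (y - act k x) (y - act k x) = h y y - (k * h x y + hconj (k * h x y)) + k * h x x * hconj k"
    using assms h_conj[of x y] diff_act by (simp add: h_left h_right algebra_simps)
  also have "k * h x y + hconj (k * h x y) = scal (htr (k * h x y))"
    by (rule hq_plus_conj)
  also have "k * h x x * hconj k = scal (b * hnorm k)"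
    by (simp add: assms scal_mult scal_left_commute scal_commute[of k] mult.assoc hconj_right)
  finally show ?thesis by (simp add: assms)
qed

text \<open>As in the LLL algorithm, a shear followed by a swap decreases the pair of leading minors
  \<open>(a, a b - N(u))\<close> lexicographically unless \<open>a\<^sup>2 \<le> 2 d\<close> and \<open>d\<^sup>2 \<le> 2 a D\<close>, where \<open>d = a b - N(u)\<close>.\<close>

lemma exists_short_vector:
  assumes "b1 \<in> S" "b2 \<in> S" "b3 \<in> S"
    and "h b1 b1 = scal a" "h b2 b2 = scal b" "h b3 b3 = scal c"
    and "0 < a" "0 < a * b - hnorm (h b1 b2)"
    and "hdisc a b c (h b1 b2) (h b2 b3) (h b1 b3) = D" "0 < D"
  shows "\<exists>y\<in>S. \<exists>m. h y y = scal m \<and> 0 < m \<and> m ^ 3 \<le> 8 * D"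
  using assms
proof (induction "nat a" arbitrary: a b c b1 b2 b3 rule: less_induct)
  case outer: less
  show ?case
    using outer.prems
  proof (induction "nat (a * b - hnorm (h b1 b2))" arbitrary: b c b2 b3 rule: less_induct)
    case inner: less
    define u v w where "u = h b1 b2" and "v = h b2 b3" and "w = h b1 b3"
    define d where "d = a * b - hnorm u"
    note S = inner.prems(1-3)
    note a = inner.prems(7)
    have d: "0 < d" using inner.prems by (simp add: d_def u_def)
    have D: "hdisc a b c u v w = D" using inner.prems by (simp add: u_def v_def w_def)
    consider "2 * d < a\<^sup>2" | "2 * a * D < d\<^sup>2" | "a\<^sup>2 \<le> 2 * d" "d\<^sup>2 \<le> 2 * a * D"
      by linarith
    then show ?case
    proof cases
      \<comment> \<open>Shear b2 by b1 so that 2 N(u) \<le> a^2. The minor d is unchanged, hence 2 a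
        b' = 2 d + 2 N(u) < 2 a^2, and swapping b1 with the new b2 lowers \<open>a\<close>.\<close>
      case 1
      obtain k where k: "2 * hnorm (hconj u - scal a * k) \<le> a\<^sup>2"
        using hq_division a by blast
      define b2' where "b2' = b2 - act k b1"
      define b' where "b' = b - htr (k * u) + a * hnorm k"
      have S': "b2' \<in> S" using S diff_act by (simp add: b2'_def)
      have bb: "h b2' b2' = scal b'"
        unfolding b2'_def b'_def u_def by (rule h_shear) (use inner.prems in auto)
      have u': "h b1 b2' = u - scal a * hconj k" "h b2' b3 = v - k * w"
        using S inner.prems(4) by (simp_all add: b2'_def h_left h_right u_def v_def w_def)
      have D': "hdisc a b' c (h b1 b2') (h b2' b3) w = D"
        using hdisc_shear12[of a b k u c v w] a D by (simp add: b'_def u')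
      have "hnorm (u - scal a * hconj k) = hnorm (hconj (u - scal a * hconj k))"
        by (simp only: hnorm_conj)
      also have "hconj (u - scal a * hconj k) = hconj u - scal a * k"
        by (simp add: scal_commute[of k])
      finally have nu: "2 * hnorm (h b1 b2') \<le> a\<^sup>2" using k by (simp add: u')
      have ab: "a * b' - hnorm (h b1 b2') = d"
        using htr_mult_commute[of k u]
        by (simp add: b'_def d_def u' hnorm_diff algebra_simps power2_eq_square
            scal_commute[of k] scal_left_commute)
      then have "a * b' > 0" using d hnorm_nonneg[of "h b1 b2'"] by linarith
      then have b': "b' > 0" using a by (simp add: zero_less_mult_iff)
      have "2 * (a * b') < 2 * (a * a)" using ab nu 1 by (simp add: power2_eq_square)
      then have "b' < a" using a by simp
      show ?thesis
      proof (rule outer.hyps[of b' b2' b1 b3 a c])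
        show "0 < b' * a - hnorm (h b2' b1)"
          using ab d h_conj[of b1 b2'] S S' by (simp add: mult.commute)
        show "hdisc b' a c (h b2' b1) (h b1 b3) (h b2' b3) = D"
          using D' hdisc_swap12[of b' a c "h b1 b2'" w "h b2' b3"] h_conj[of b1 b2'] S S'
          by (simp add: w_def)
      qed (use \<open>b' < a\<close> b' S S' bb inner.prems in auto)
    next
      \<comment> \<open>The same step for the projected form (d, P, e): after shearing b3 by b2, 2 d
        e = 2 a D + 2 N(P) < 2 d^2, so swapping b2 with the new b3 keeps \<open>a\<close> and lowers
        the second minor from d to e.\<close>
      case 2
      define P where "P = scal a * v - hconj u * w"
      obtain k where k: "2 * hnorm (hconj P - scal d * k) \<le> d\<^sup>2"
        using hq_division d by blast
      define b3' where "b3' = b3 - act k b2"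
      define c' where "c' = c - htr (k * v) + b * hnorm k"
      have S': "b3' \<in> S" using S diff_act by (simp add: b3'_def)
      have cc: "h b3' b3' = scal c'"
        unfolding b3'_def c'_def v_def by (rule h_shear) (use inner.prems in auto)
      have v': "h b2 b3' = v - scal b * hconj k" "h b1 b3' = w - u * hconj k"
        using S inner.prems by (simp_all add: b3'_def h_right u_def v_def w_def)
      have D': "hdisc a b c' u (h b2 b3') (h b1 b3') = D"
        using hdisc_shear23[of a b c k v u w] a D by (simp add: c'_def v')
      have "scal a * h b2 b3' - hconj u * h b1 b3' = P - scal d * hconj k"
        by (simp add: P_def d_def v' algebra_simps scal_mult)
          (simp add: mult.assoc[symmetric] hconj_left)
      then have P': "scal a * h b2 b3' - hconj u * h b1 b3' = hconj (hconj P - scal d * k)"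
        by (simp add: scal_commute[of "hconj k"])
      define e where "e = a * c' - hnorm (h b1 b3')"
      have e: "a * D = d * e - hnorm (hconj P - scal d * k)"
        using hdisc_sylvester[of a b c' u "h b2 b3'" "h b1 b3'"]
        by (simp only: D' P' hnorm_conj d_def[symmetric] e_def[symmetric])
      have "a * D > 0" using a inner.prems by simp
      then have "d * e > 0" using e hnorm_nonneg[of "hconj P - scal d * k"] by linarith
      then have e0: "e > 0" using d by (simp add: zero_less_mult_iff)
      have "2 * (d * e) < 2 * (d * d)" using e k 2 by (simp add: power2_eq_square)
      then have "e < d" using d by simp
      show ?thesis
      proof (rule inner.hyps[of c' b3' b2 b])
        show "nat (a * c' - hnorm (h b1 b3')) < nat (a * b - hnorm (h b1 b2))"
          using \<open>e < d\<close> e0 by (simp add: e_def d_def u_def)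
        show "0 < a * c' - hnorm (h b1 b3')" using e0 by (simp add: e_def)
        show "hdisc a c' b (h b1 b3') (h b3' b2) (h b1 b2) = D"
          using D' hdisc_swap23[of a c' b "h b1 b3'" "h b2 b3'" u] h_conj[of b2 b3'] S S'
          by (simp add: u_def)
      qed (use S S' cc inner.prems in auto)
    next
      \<comment> \<open>Now a^4 \<le> 4 d^2 \<le> 8 a D, so \<open>b1\<close> itself is
        short.\<close>
      case 3
      have "a\<^sup>2 * a\<^sup>2 \<le> (2 * d) * (2 * d)"
        by (rule mult_mono) (use 3 d in auto)
      also have "\<dots> \<le> 4 * (2 * a * D)" using 3 by (simp add: power2_eq_square algebra_simps)
      finally have "a * (a ^ 3) \<le> a * (8 * D)"
        by (simp add: power2_eq_square power3_eq_cube)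
      then have "a ^ 3 \<le> 8 * D" using a by simp
      then show ?thesis using inner.prems by blast
    qed
  qed
qed

end

section \<open>Norms, traces and total positivity in the cubic ring\<close>

lemma cub_map [simp]:
  "cf0 (map_cub f x) = f (cf0 x)" "cf1 (map_cub f x) = f (cf1 x)" "cf2 (map_cub f x) = f (cf2 x)"
  by (cases x; simp)+

text \<open>The automorphism \<open>\<theta> \<mapsto> \<theta>\<^sup>2 - 2\<close>.\<close>

definition csig :: "'a::comm_ring_1 cub \<Rightarrow> 'a cub" where
  "csig x = Cub (cf0 x - 2 * cf1 x + 3 * cf2 x) (- cf2 x) (cf1 x - cf2 x)"

lemma csig_simps [simp]:
  "cf0 (csig x) = cf0 x - 2 * cf1 x + 3 * cf2 x" "cf1 (csig x) = - cf2 x"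
  "cf2 (csig x) = cf1 x - cf2 x"
  by (simp_all add: csig_def)

lemma csig_hom [simp]:
  "csig 0 = 0" "csig 1 = 1" "csig (x + y) = csig x + csig y" "csig (x - y) = csig x - csig y"
  "csig (of_int n) = of_int n" "csig (x * y) = csig x * csig y"
  by (simp_all add: cub_eq_iff cub_mult algebra_simps)

lemma csig_csig_csig [simp]: "csig (csig (csig x)) = x"
  by (simp add: cub_eq_iff algebra_simps)

lemma cub_ctr: "x + csig x + csig (csig x) = Cub (ctr x) 0 0"
  by (simp add: cub_eq_iff ctr_def algebra_simps)

lemma cadj_eq: "cadj x = csig x * csig (csig x)"
  by (simp add: cub_eq_iff cub_mult cadj_def Let_def algebra_simps power2_eq_square)

lemma cnorm_mult [simp]: "cnorm (x * y) = cnorm x * cnorm y"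
proof -
  have "Cub (cnorm (x * y)) 0 0 = (x * cadj x) * (y * cadj y)"
    by (simp only: cub_adj[symmetric] cadj_eq csig_hom mult.assoc mult.left_commute mult.commute)
  also have "\<dots> = Cub (cnorm x * cnorm y) 0 0"
    by (simp add: cub_adj cub_eq_iff cub_mult)
  finally show ?thesis by simp
qed

text \<open>For t = z + 1/z the number t^2 - 2 = z^2 + 1/z^2 is the next conjugate. Both claims are
  checked by reducing powers of \<open>t\<close> modulo the cubic.\<close>

lemma is_root_sigma:
  assumes "is_root t"
  shows "is_root (t\<^sup>2 - 2)" "(t\<^sup>2 - 2)\<^sup>2 = 3 - t - t\<^sup>2"
proof -
  have t3: "t ^ 3 = 1 + 2 * t - t\<^sup>2" using assms by (simp add: is_root_def)
  have t4: "t ^ 4 = - 1 - t + 3 * t\<^sup>2"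
  proof -
    have "t ^ 4 = t * t ^ 3" by (simp add: power_Suc[symmetric])
    also have "\<dots> = t * (1 + 2 * t - t\<^sup>2)" by (simp only: t3)
    also have "\<dots> = t + 2 * t\<^sup>2 - t ^ 3"
      by (simp add: algebra_simps power2_eq_square power3_eq_cube)
    finally show ?thesis by (simp add: t3 algebra_simps)
  qed
  show 2: "(t\<^sup>2 - 2)\<^sup>2 = 3 - t - t\<^sup>2"
  proof -
    have "(t\<^sup>2 - 2)\<^sup>2 = t ^ 4 - 4 * t\<^sup>2 + 4"
      by (simp add: algebra_simps power2_eq_square power4_eq_xxxx)
    then show ?thesis by (simp add: t4)
  qed
  have "(t\<^sup>2 - 2) ^ 3 = (t\<^sup>2 - 2) * (3 - t - t\<^sup>2)"
    by (simp only: 2[symmetric]) (simp add: power2_eq_square power3_eq_cube mult.assoc)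
  also have "\<dots> = 5 * t\<^sup>2 - t ^ 3 - t ^ 4 - 6 + 2 * t"
    by (simp add: algebra_simps power2_eq_square power3_eq_cube power4_eq_xxxx)
  also have "\<dots> = 1 + 2 * (t\<^sup>2 - 2) - (t\<^sup>2 - 2)\<^sup>2"
    by (simp only: t3 t4 2) (simp add: algebra_simps)
  finally show "is_root (t\<^sup>2 - 2)" by (simp add: is_root_def)
qed

lemma ev_csig:
  assumes "is_root t"
  shows "ev t (csig x) = ev (t\<^sup>2 - 2) x"
  by (simp add: ev_def is_root_sigma[OF assms] algebra_simps)

section \<open>Evaluation of integral elements, and total positivity\<close>

definition evi :: "'a::comm_ring_1 \<Rightarrow> int cub \<Rightarrow> 'a" where
  "evi t x = ev t (map_cub of_int x)"

lemma map_cub_of_int_hom [simp]: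
  "map_cub of_int 0 = 0" "map_cub of_int 1 = 1"
  "map_cub of_int (x + y) = map_cub of_int x + map_cub of_int y"
  "map_cub of_int (x - y) = map_cub of_int x - map_cub of_int y"
  "map_cub of_int (- x) = - map_cub of_int x"
  "map_cub of_int (x * y) = map_cub of_int x * map_cub of_int y"
  "map_cub of_int (of_int n) = of_int n"
  "map_cub of_int (csig x) = csig (map_cub of_int x)"
  by (simp_all add: cub_eq_iff cub_mult)

lemma evi_simps [simp]:
  "evi t 0 = 0" "evi t 1 = 1" "evi t (x + y) = evi t x + evi t y" "evi t (x - y) = evi t x - evi t y"
  "evi t (of_int n) = of_int n" "evi t (- x) = - evi t x"
  by (simp_all add: evi_def)

lemma evi_mult [simp]: "is_root t \<Longrightarrow> evi t (x * y) = evi t x * evi t y"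
  by (simp add: evi_def)

lemma evi_power [simp]: "is_root t \<Longrightarrow> evi t (x ^ n) = evi t x ^ n"
  by (induction n) simp_all

lemma evi_numeral [simp]: "evi t (numeral n) = numeral n"
  using evi_simps(5)[of t "numeral n"] by (simp del: evi_simps(5))

lemma evi_csig: "is_root t \<Longrightarrow> evi t (csig x) = evi (t\<^sup>2 - 2) x"
  by (simp add: evi_def ev_csig)

lemma cub_adj_int: "(x :: int cub) * cadj x = of_int (cnorm x)"
  by (simp add: cub_adj of_int_cub)

lemma cub_ctr_int: "(x :: int cub) + csig x + csig (csig x) = of_int (ctr x)"
  by (simp add: cub_ctr of_int_cub)

lemma two_dvd_cub_iff: "2 dvd (x :: int cub) \<longleftrightarrow> even (cf0 x) \<and> even (cf1 x) \<and> even (cf2 x)"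
proof
  assume "even (cf0 x) \<and> even (cf1 x) \<and> even (cf2 x)"
  then obtain a b c where "cf0 x = 2 * a" "cf1 x = 2 * b" "cf2 x = 2 * c"
    by (auto elim!: evenE)
  then have "x = 2 * Cub a b c" by (simp add: cub_eq_iff cub_mult)
  then show "2 dvd x" by simp
qed (auto simp: cub_mult)

text \<open>2 is inert, the minimal polynomial of \<open>\<theta>\<close> being irreducible modulo 2.\<close>

lemma even_cnorm:
  fixes x :: "int cub"
  assumes "even (cnorm x)"
  shows "2 dvd x"
  using assms by (auto simp: two_dvd_cub_iff cnorm_def Let_def)

text \<open>Infinite descent: norm 0 is even, so \<open>even_cnorm\<close> allows halving
  \<open>x\<close> forever, while the coefficients shrink.\<close>

lemma cnorm_eq_0_iff: "cnorm (x :: int cub) = 0 \<longleftrightarrow> x = 0"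
proof
  assume "cnorm x = 0"
  then show "x = 0"
  proof (induction "nat (\<bar>cf0 x\<bar> + \<bar>cf1 x\<bar> + \<bar>cf2 x\<bar>)" arbitrary: x rule: less_induct)
    case less
    obtain y where y: "x = 2 * y" using even_cnorm[of x] less.prems by auto
    have "cnorm (2 :: int cub) = 8" by (simp add: cnorm_def)
    then have "cnorm y = 0" using less.prems by (simp add: y)
    show ?case
    proof (cases "y = 0")
      case False
      then have "nat (\<bar>cf0 y\<bar> + \<bar>cf1 y\<bar> + \<bar>cf2 y\<bar>) < nat (\<bar>cf0 x\<bar> + \<bar>cf1 x\<bar> + \<bar>cf2 x\<bar>)"
        by (auto simp: y cub_eq_iff cub_mult)
      then show ?thesis using less.hyps \<open>cnorm y = 0\<close> False by blast
    qed (simp add: y)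
  qed
qed (simp add: cnorm_def)

lemma of_int_mult_cub:
  "cf0 (of_int n * x) = of_int n * cf0 x" "cf1 (of_int n * x) = of_int n * cf1 x"
  "cf2 (of_int n * x) = of_int n * cf2 x"
  by (simp_all add: cub_mult)

lemma cub_cancel:
  fixes x y z :: "int cub"
  assumes "x \<noteq> 0" "x * y = x * z"
  shows "y = z"
proof -
  have "of_int (cnorm x) * (y - z) = cadj x * (x * y - x * z)"
    by (simp add: cub_adj_int[symmetric] algebra_simps)
  also have "\<dots> = 0" using assms by simp
  finally show ?thesis using assms(1)
    by (auto simp: cub_eq_iff of_int_mult_cub cnorm_eq_0_iff)
qed

lemma evi_eq_0_iff:
  fixes t :: "'a::{comm_ring_1, ring_char_0}"
  assumes "is_root t"
  shows "evi t x = 0 \<longleftrightarrow> x = 0"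
proof
  assume "evi t x = 0"
  then have "evi t (x * cadj x) = 0" using assms by simp
  then show "x = 0" unfolding cub_adj_int by (simp add: cnorm_eq_0_iff)
qed simp

text \<open>One real root suffices, because \<open>csig\<close> carries it to the other two real
  roots (\<open>evi_csig\<close>).\<close>

definition tpos :: "real \<Rightarrow> int cub \<Rightarrow> bool" where
  "tpos t x \<longleftrightarrow> evi t x > 0 \<and> evi t (csig x) > 0 \<and> evi t (csig (csig x)) > 0"

text \<open>The three integers are the elementary symmetric functions of the three positive
  conjugates.\<close>

lemma tpos_pos:
  assumes "is_root t" "tpos t x"
  shows "ctr x > 0" "ctr (cadj x) > 0" "cnorm x > 0"
proof -
  have "(of_int (ctr x) :: real) = evi t (x + csig x + csig (csig x))"
    by (simp only: cub_ctr_int evi_simps)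
  also have "\<dots> > 0" using assms by (simp add: tpos_def)
  finally show "ctr x > 0" by simp
  have "(of_int (cnorm x) :: real) = evi t (x * cadj x)"
    by (simp only: cub_adj_int evi_simps)
  also have "\<dots> > 0" using assms by (simp add: tpos_def cadj_eq)
  finally show "cnorm x > 0" by simp
  have "(of_int (ctr (cadj x)) :: real) = evi t (cadj x + csig (cadj x) + csig (csig (cadj x)))"
    by (simp only: cub_ctr_int evi_simps)
  also have "\<dots> > 0" using assms by (simp add: tpos_def cadj_eq add_pos_pos)
  finally show "ctr (cadj x) > 0" by simp
qed

text \<open>Here x, y, z are coordinates in the normal integral basis of the conjugates \<theta>,
  \<theta>^2 - 2, 1 - \<theta> - \<theta>^2, each of trace -1, so the trace of \<open>m\<close> is
  -(x + y + z).\<close>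

definition small_trace_check :: "int \<Rightarrow> int \<Rightarrow> int \<Rightarrow> bool" where
  "small_trace_check x y z \<longleftrightarrow>
     (let m = Cub (z - 2 * y) (x - z) (y - z) in
      x + y + z < 0 \<and> - 7 \<le> x + y + z \<and> 0 < ctr (cadj m) \<and> 0 < cnorm m \<longrightarrow>
      m \<in> {Cub 2 (-1) 0, Cub 0 (-1) 1, Cub 4 0 (-1), Cub 5 (-1) (-2), Cub 1 1 1, Cub 2 0 0,
        Cub 3 (-1) (-1), Cub 0 0 1, Cub 1 2 1, Cub 2 1 0, Cub 1 0 0})"

lemma small_trace_table:
  "\<forall>x\<in>set [-4..4]. \<forall>y\<in>set [-4..4]. \<forall>z\<in>set [-4..4]. small_trace_check x y z"
  by code_simp

lemma small_trace_cases:
  fixes m :: "int cub"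
  assumes "0 < ctr m" "ctr m \<le> 7" "0 < ctr (cadj m)" "0 < cnorm m"
  shows "\<exists>u v k. u * v = 1 \<and> m = u * u * k \<and> (k = 1 \<or> k = 2 \<or> k = Cub 2 (-1) 0)"
proof -
  define x y z where "x = cf1 m - cf0 m - 2 * cf2 m" and "y = - cf0 m - cf2 m"
    and "z = - cf0 m - 2 * cf2 m"
  have m: "m = Cub (z - 2 * y) (x - z) (y - z)"
    by (simp add: cub_eq_iff x_def y_def z_def)
  have tr: "x + y + z = - ctr m" by (simp add: ctr_def x_def y_def z_def)
  \<comment> \<open>The trace of m^2, computed in the normal basis and as the trace squared minus
    twice the second symmetric function. It gives x^2 + y^2 + z^2 < 21.\<close>
  have "7 * (x\<^sup>2 + y\<^sup>2 + z\<^sup>2) = 3 * (ctr m)\<^sup>2 - 2 * ctr (cadj m)"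
    by (simp add: x_def y_def z_def ctr_def cadj_def Let_def algebra_simps power2_eq_square)
  moreover have "(ctr m)\<^sup>2 \<le> 7\<^sup>2" by (rule power_mono) (use assms in auto)
  ultimately have "x\<^sup>2 + y\<^sup>2 + z\<^sup>2 < 5\<^sup>2" using assms by simp
  then have "x\<^sup>2 < 5\<^sup>2" "y\<^sup>2 < 5\<^sup>2" "z\<^sup>2 < 5\<^sup>2"
    by (smt (verit) zero_le_power2)+
  then have "\<bar>x\<bar> < 5" "\<bar>y\<bar> < 5" "\<bar>z\<bar> < 5"
    by (auto intro: power2_less_imp_less[of _ 5])
  then have "x \<in> set [-4..4]" "y \<in> set [-4..4]" "z \<in> set [-4..4]" by auto
  then have "m \<in> {Cub 2 (-1) 0, Cub 0 (-1) 1, Cub 4 0 (-1), Cub 5 (-1) (-2), Cub 1 1 1, Cub 2 0 0,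
        Cub 3 (-1) (-1), Cub 0 0 1, Cub 1 2 1, Cub 2 1 0, Cub 1 0 0}"
  proof -
    have "small_trace_check x y z"
      using small_trace_table \<open>x \<in> _\<close> \<open>y \<in> _\<close> \<open>z \<in> _\<close> by blast
    then show ?thesis
      using tr assms unfolding small_trace_check_def Let_def m[symmetric] by linarith
  qed
  then consider "m = Cub 2 (-1) 0" |
    "m = Cub 0 (-1) 1" |
    "m = Cub 4 0 (-1)" |
    "m = Cub 5 (-1) (-2)" |
    "m = Cub 1 1 1" |
    "m = Cub 2 0 0" |
    "m = Cub 3 (-1) (-1)" |
    "m = Cub 0 0 1" |
    "m = Cub 1 2 1" |
    "m = Cub 2 1 0" |
    "m = Cub 1 0 0"
    by blast
  then show ?thesis
  \<comment> \<open>The witness \<open>v\<close> is the inverse of the unit \<open>u\<close>. Cases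
    1, 3 and 5 are the three conjugates of 2 - \<theta>, case 6 is 2, and the others are squares of
    units.\<close>
  proof cases
    case 1
    show ?thesis
      by (rule exI[of _ "Cub (-1) 0 0"], rule exI[of _ "Cub (-1) 0 0"], rule exI[of _ "(Cub 2 (-1) 0)"])
        (simp add: 1 cub_eq_iff cub_mult)
  next
    case 2
    show ?thesis
      by (rule exI[of _ "Cub (-1) 0 1"], rule exI[of _ "Cub (-1) 1 1"], rule exI[of _ "1"])
        (simp add: 2 cub_eq_iff cub_mult)
  next
    case 3
    show ?thesis
      by (rule exI[of _ "Cub (-1) 1 1"], rule exI[of _ "Cub (-1) 0 1"], rule exI[of _ "(Cub 2 (-1) 0)"])
        (simp add: 3 cub_eq_iff cub_mult)
  next
    case 4
    show ?thesis
      by (rule exI[of _ "Cub (-2) 1 1"], rule exI[of _ "Cub 0 1 0"], rule exI[of _ "1"])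
        (simp add: 4 cub_eq_iff cub_mult)
  next
    case 5
    show ?thesis
      by (rule exI[of _ "Cub (-1) (-1) 0"], rule exI[of _ "Cub (-2) 0 1"], rule exI[of _ "(Cub 2 (-1) 0)"])
        (simp add: 5 cub_eq_iff cub_mult)
  next
    case 6
    show ?thesis
      by (rule exI[of _ "Cub (-1) 0 0"], rule exI[of _ "Cub (-1) 0 0"], rule exI[of _ "2"])
        (simp add: 6 cub_eq_iff cub_mult)
  next
    case 7
    show ?thesis
      by (rule exI[of _ "Cub (-2) 0 1"], rule exI[of _ "Cub (-1) (-1) 0"], rule exI[of _ "1"])
        (simp add: 7 cub_eq_iff cub_mult)
  next
    case 8
    show ?thesis
      by (rule exI[of _ "Cub 0 (-1) 0"], rule exI[of _ "Cub 2 (-1) (-1)"], rule exI[of _ "1"])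
        (simp add: 8 cub_eq_iff cub_mult)
  next
    case 9
    show ?thesis
      by (rule exI[of _ "Cub (-1) (-1) 0"], rule exI[of _ "Cub (-2) 0 1"], rule exI[of _ "1"])
        (simp add: 9 cub_eq_iff cub_mult)
  next
    case 10
    show ?thesis
      by (rule exI[of _ "Cub (-1) 1 1"], rule exI[of _ "Cub (-1) 0 1"], rule exI[of _ "1"])
        (simp add: 10 cub_eq_iff cub_mult)
  next
    case 11
    show ?thesis
      by (rule exI[of _ "Cub (-1) 0 0"], rule exI[of _ "Cub (-1) 0 0"], rule exI[of _ "1"])
        (simp add: 11 cub_eq_iff cub_mult)
  qed
qed

section \<open>Adapted bases of principal ideals\<close>

lemma int_subgroup_generator:
  fixes I :: "int set"
  assumes "x \<in> I" "x \<noteq> 0" "\<And>x y k. x \<in> I \<Longrightarrow> y \<in> I \<Longrightarrow> x - k * y \<in> I"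
  obtains g where "g > 0" "g \<in> I" "\<And>x. x \<in> I \<Longrightarrow> g dvd x"
proof -
  define P where "P n \<longleftrightarrow> n > 0 \<and> int n \<in> I" for n
  have z: "0 \<in> I" using assms(3)[OF assms(1) assms(1), of 1] by simp
  have "- x \<in> I" using assms(3)[OF z assms(1), of 1] by simp
  then have "P (nat \<bar>x\<bar>)" using assms(1,2) by (auto simp: P_def abs_if)
  then have g: "P (LEAST n. P n)" by (rule LeastI)
  define g where "g = int (LEAST n. P n)"
  have g0: "g > 0" using g by (simp add: P_def g_def)
  have "g dvd y" if "y \<in> I" for y
  proof (rule ccontr)
    assume "\<not> g dvd y"
    then have m: "y mod g > 0" "y mod g < g"
      using pos_mod_bound[OF g0, of y] pos_mod_sign[OF g0, of y] by (simp_all add: dvd_eq_mod_eq_0)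
    have "y mod g \<in> I"
      using assms(3)[OF that, of g "y div g"] g
      by (simp add: P_def g_def minus_div_mult_eq_mod)
    then have "P (nat (y mod g))" using m by (simp add: P_def)
    then have "(LEAST n. P n) \<le> nat (y mod g)" by (rule Least_le)
    then show False using m by (simp add: g_def)
  qed
  then show ?thesis using that[of g] g by (simp add: g_def P_def)
qed

definition cdet :: "int cub \<Rightarrow> int cub \<Rightarrow> int cub \<Rightarrow> int" where
  "cdet x y z = cf0 x * (cf1 y * cf2 z - cf2 y * cf1 z) - cf1 x * (cf0 y * cf2 z - cf2 y * cf0 z)
     + cf2 x * (cf0 y * cf1 z - cf1 y * cf0 z)"

lemma cnorm_eq_cdet: "cnorm x = cdet x (Cub 0 1 0 * x) (Cub 0 1 0 * (Cub 0 1 0 * x))"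
  by (simp add: cnorm_def cdet_def cub_mult Let_def algebra_simps power2_eq_square power3_eq_cube)

text \<open>The cofactor is the determinant of the coefficient matrix. With
  \<open>cnorm_eq_cdet\<close> this makes the index of a triangular lattice containing \<alpha>,
  \<theta> \<alpha>, \<theta>^2 \<alpha> divide the norm of \<alpha>.\<close>

lemma cdet_triangular:
  assumes "\<And>i. i \<in> {x, y, z} \<Longrightarrow> \<exists>a b c. i = of_int a * Cub p q c2 + of_int b * Cub r c1 0 + of_int c * Cub c0 0 0"
  shows "c0 * c1 * c2 dvd cdet x y z"
proof -
  obtain a b c where x: "x = of_int a * Cub p q c2 + of_int b * Cub r c1 0 + of_int c * Cub c0 0 0"
    using assms[of x] by auto
  obtain a' b' c' where y: "y = of_int a' * Cub p q c2 + of_int b' * Cub r c1 0 + of_int c' * Cub c0 0 0"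
    using assms[of y] by auto
  obtain a'' b'' c'' where z: "z = of_int a'' * Cub p q c2 + of_int b'' * Cub r c1 0 + of_int c'' * Cub c0 0 0"
    using assms[of z] by auto
  have "cdet x y z = (c0 * c1 * c2) * cdet (Cub c b a) (Cub c' b' a') (Cub c'' b'' a'')"
    by (simp add: cdet_def x y z of_int_mult_cub algebra_simps)
  then show ?thesis by simp
qed

text \<open>The Hermite normal form of an ideal of \<open>\<int>[X]/(f)\<close>, \<open>f\<close> monic, is already its Smith normal form:
  multiplication by \<open>X\<close> forces each pivot to divide everything in the rows below it.\<close>

lemma principal_ideal_basis:
  fixes \<alpha> :: "int cub"
  assumes "\<alpha> \<noteq> 0"
  obtains c n1 n2 s u v s0 s1 s2 where "c > 0" "n1 > 0" "n2 > 0"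
    "\<alpha> * s0 = of_int (c * n1 * n2)" "\<alpha> * s1 = of_int (c * n1) * Cub s 1 0"
    "\<alpha> * s2 = of_int c * Cub v u 1" "(c * n1 * n2) * (c * n1) * c dvd cnorm \<alpha>"
proof -
  define J where "J = range ((*) \<alpha>)"
  have J_mult: "k * x \<in> J" if "x \<in> J" for k x
    using that by (auto simp: J_def mult.left_commute intro!: rangeI)
  have J_diff: "x - y \<in> J" if "x \<in> J" "y \<in> J" for x y
    using that by (auto simp: J_def simp flip: right_diff_distrib intro!: rangeI)
  \<comment> \<open>The norm lies in \<open>J\<close>, so N, \<theta> N and \<theta>^2 N make all
    three pivot ideals below nonzero.\<close>
  define N where "N = (of_int (cnorm \<alpha>) :: int cub)"
  have N: "N \<in> J" unfolding N_def J_def cub_adj_int[symmetric] by simp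
  have n0: "cnorm \<alpha> \<noteq> 0" using assms by (simp add: cnorm_eq_0_iff)
  define xi where "xi = (Cub 0 1 0 :: int cub)"
  define I0 where "I0 = {cf0 x |x. x \<in> J \<and> cf1 x = 0 \<and> cf2 x = 0}"
  define I1 where "I1 = {cf1 x |x. x \<in> J \<and> cf2 x = 0}"
  define I2 where "I2 = cf2 ` J"
  have sub0: "x - k * y \<in> I0" if xy: "x \<in> I0" "y \<in> I0" for x y k
  proof -
    obtain x' y' where "x = cf0 x'" "x' \<in> J" "cf1 x' = 0" "cf2 x' = 0"
      "y = cf0 y'" "y' \<in> J" "cf1 y' = 0" "cf2 y' = 0" using xy by (auto simp: I0_def)
    then show ?thesis unfolding I0_def
      by (auto simp: J_diff J_mult of_int_mult_cub intro!: exI[of _ "x' - of_int k * y'"])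
  qed
  have sub1: "x - k * y \<in> I1" if xy: "x \<in> I1" "y \<in> I1" for x y k
  proof -
    obtain x' y' where "x = cf1 x'" "x' \<in> J" "cf2 x' = 0"
      "y = cf1 y'" "y' \<in> J" "cf2 y' = 0" using xy by (auto simp: I1_def)
    then show ?thesis unfolding I1_def
      by (auto simp: J_diff J_mult of_int_mult_cub intro!: exI[of _ "x' - of_int k * y'"])
  qed
  have sub2: "x - k * y \<in> I2" if xy: "x \<in> I2" "y \<in> I2" for x y k
  proof -
    obtain x' y' where "x = cf2 x'" "x' \<in> J" "y = cf2 y'" "y' \<in> J" using xy by (auto simp: I2_def)
    then show ?thesis unfolding I2_def
      by (auto simp: J_diff J_mult of_int_mult_cub intro!: image_eqI[of _ _ "x' - of_int k * y'"])
  qed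
  have "cnorm \<alpha> \<in> I0" unfolding I0_def using N by (auto simp: N_def intro!: exI[of _ N])
  then obtain c0 where c0: "c0 > 0" "c0 \<in> I0" "\<And>x. x \<in> I0 \<Longrightarrow> c0 dvd x"
    using int_subgroup_generator[of _ I0] n0 sub0 by metis
  have "cnorm \<alpha> \<in> I1" unfolding I1_def using J_mult[OF N, of xi]
    by (auto simp: N_def xi_def cub_mult intro!: exI[of _ "xi * N"])
  then obtain c1 where c1: "c1 > 0" "c1 \<in> I1" "\<And>x. x \<in> I1 \<Longrightarrow> c1 dvd x"
    using int_subgroup_generator[of _ I1] n0 sub1 by metis
  have "cnorm \<alpha> \<in> I2" unfolding I2_def using J_mult[OF N, of "xi * xi"]
    by (auto simp: N_def xi_def cub_mult intro!: image_eqI[of _ _ "xi * xi * N"])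
  then obtain c2 where c2: "c2 > 0" "c2 \<in> I2" "\<And>x. x \<in> I2 \<Longrightarrow> c2 dvd x"
    using int_subgroup_generator[of _ I2] n0 sub2 by metis
  have g0: "Cub c0 0 0 \<in> J" using c0(2) by (auto simp: I0_def) (metis cub.collapse)
  obtain r where g1: "Cub r c1 0 \<in> J" using c1(2) by (auto simp: I1_def) (metis cub.collapse)
  obtain p q where g2: "Cub p q c2 \<in> J" using c2(2) by (auto simp: I2_def) (metis cub.collapse)
  have dec0: "\<exists>k. x = of_int k * Cub c0 0 0" if "x \<in> J" "cf1 x = 0" "cf2 x = 0" for x
  proof -
    have "c0 dvd cf0 x" using that c0(3) by (auto simp: I0_def)
    then show ?thesis using that by (auto simp: cub_eq_iff of_int_mult_cub)
  qed
  have dec1: "\<exists>l k. x = of_int l * Cub r c1 0 + of_int k * Cub c0 0 0"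
    if x: "x \<in> J" "cf2 x = 0" for x
  proof -
    have "c1 dvd cf1 x" using that c1(3) by (auto simp: I1_def)
    then obtain l where l: "cf1 x = c1 * l" ..
    have "x - of_int l * Cub r c1 0 \<in> J" using that J_diff J_mult[OF g1] by blast
    then obtain k where "x - of_int l * Cub r c1 0 = of_int k * Cub c0 0 0"
      using dec0[of "x - of_int l * Cub r c1 0"] x l by (auto simp: of_int_mult_cub)
    then have "x = of_int l * Cub r c1 0 + of_int k * Cub c0 0 0" by (simp add: algebra_simps)
    then show ?thesis by blast
  qed
  have dec2: "\<exists>m l k. x = of_int m * Cub p q c2 + of_int l * Cub r c1 0 + of_int k * Cub c0 0 0"
    if "x \<in> J" for x
  proof -
    have "c2 dvd cf2 x" using that c2(3) by (auto simp: I2_def)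
    then obtain m where m: "cf2 x = c2 * m" ..
    have "x - of_int m * Cub p q c2 \<in> J" using that J_diff J_mult[OF g2] by blast
    then obtain l k where "x - of_int m * Cub p q c2 = of_int l * Cub r c1 0 + of_int k * Cub c0 0 0"
      using dec1[of "x - of_int m * Cub p q c2"] m by (auto simp: of_int_mult_cub)
    then have "x = of_int m * Cub p q c2 + of_int l * Cub r c1 0 + of_int k * Cub c0 0 0"
      by (simp add: algebra_simps)
    then show ?thesis by blast
  qed
  have "c1 \<in> I2" unfolding I2_def
    by (rule image_eqI[OF _ J_mult[OF g1, of xi]]) (simp add: xi_def cub_mult)
  then have "c2 dvd c1" by (rule c2(3))
  then obtain n1 where n1: "c1 = c2 * n1" ..
  have "c0 \<in> I1" unfolding I1_def
    using J_mult[OF g0, of xi] by (force simp: xi_def cub_mult intro!: exI[of _ "xi * Cub c0 0 0"])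
  then have "c1 dvd c0" by (rule c1(3))
  then obtain n2 where n2: "c0 = c1 * n2" ..
  have n: "n1 > 0" "n2 > 0" using c0(1) c1(1) c2(1) n1 n2 by (auto simp: zero_less_mult_iff)
  \<comment> \<open>The \<theta>-coefficients cancel, leaving an integer n2 r of the ideal, which c0
    = c1 n2 must divide.\<close>
  have "of_int n2 * Cub r c1 0 - xi * Cub c0 0 0 \<in> J" using J_diff J_mult g0 g1 by blast
  then have "c0 dvd n2 * r"
    using dec0[of "of_int n2 * Cub r c1 0 - xi * Cub c0 0 0"]
    by (auto simp: xi_def cub_mult of_int_mult_cub cub_eq_iff n2)
  then have "c1 dvd r" using n by (simp add: n2 mult.commute)
  then obtain s where s: "r = c1 * s" ..
  \<comment> \<open>Now the \<theta>^2-coefficients cancel; comparing the two remaining coefficients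
    shows that \<open>c2\<close> divides \<open>p\<close> and \<open>q\<close>.\<close>
  have "of_int n1 * Cub p q c2 - xi * Cub r c1 0 \<in> J" using J_diff J_mult g2 g1 by blast
  then obtain l k where
    "of_int n1 * Cub p q c2 - xi * Cub r c1 0 = of_int l * Cub r c1 0 + of_int k * Cub c0 0 0"
    using dec1[of "of_int n1 * Cub p q c2 - xi * Cub r c1 0"]
    by (auto simp: xi_def cub_mult of_int_mult_cub n1)
  then have "n1 * q = n1 * (c2 * (l + s))" "n1 * p = n1 * (c2 * (l * s + k * n2))"
    by (simp_all add: xi_def cub_mult of_int_mult_cub cub_eq_iff n1 n2 s algebra_simps)
  then have "q = c2 * (l + s)" "p = c2 * (l * s + k * n2)" using n by simp_all
  then obtain v u where vu: "p = c2 * v" "q = c2 * u" by blast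
  have J: "\<alpha> \<in> J" unfolding J_def by (metis mult.right_neutral rangeI)
  have "c0 * c1 * c2 dvd cnorm \<alpha>"
    unfolding cnorm_eq_cdet
    by (rule cdet_triangular[of _ _ _ p q _ r]) (auto intro!: dec2 J_mult J)
  moreover obtain s0 where "\<alpha> * s0 = Cub c0 0 0" using g0 by (auto simp: J_def)
  then have "\<alpha> * s0 = of_int (c2 * n1 * n2)" by (simp add: of_int_cub n1 n2)
  moreover obtain s1 where "\<alpha> * s1 = Cub r c1 0" using g1 by (auto simp: J_def)
  then have "\<alpha> * s1 = of_int (c2 * n1) * Cub s 1 0"
    by (simp add: cub_eq_iff n1 s of_int_mult_cub del: of_int_mult)
  moreover obtain s2 where "\<alpha> * s2 = Cub p q c2" using g2 by (auto simp: J_def)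
  then have "\<alpha> * s2 = of_int c2 * Cub v u 1"
    by (simp add: cub_eq_iff vu of_int_mult_cub)
  ultimately show ?thesis
    using that[of c2 n1 n2 s0 s1 s s2 v u] c2(1) n n1 n2 by simp
qed

section \<open>Short vectors\<close>

lemma hq_map [simp]:
  "hq1 (map_hq f x) = f (hq1 x)" "hqi (map_hq f x) = f (hqi x)"
  "hqj (map_hq f x) = f (hqj x)" "hqw (map_hq f x) = f (hqw x)"
  by (cases x; simp)+

definition lift :: "int hq \<Rightarrow> int cub hq" where
  "lift x = map_hq of_int x"

lemma lift_hom [simp]:
  "lift 0 = 0" "lift (x + y) = lift x + lift y" "lift (x - y) = lift x - lift y"
  "lift (x * y) = lift x * lift y" "lift (hconj x) = hconj (lift x)"
  "lift (scal n) = scal (of_int n)" "lift 1 = 1"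
  by (simp_all add: lift_def hq_eq_iff hq_mult)

lemma hnorm_lift [simp]: "hnorm (lift x) = of_int (hnorm x)"
  by (simp add: lift_def hnorm_def)

definition hctr :: "int cub hq \<Rightarrow> int hq" where
  "hctr x = map_hq ctr x"

lemma ctr_simps [simp]:
  "ctr 0 = 0" "ctr (x + y) = ctr x + ctr y" "ctr (x - y) = ctr x - ctr y"
  "ctr (of_int n * x) = of_int n * ctr x" "ctr (- x) = - ctr x"
  by (simp_all add: ctr_def of_int_mult_cub right_diff_distrib distrib_left mult.left_commute)

lemma hctr_simps [simp]:
  "hctr (x - y) = hctr x - hctr y" "hctr (hconj x) = hconj (hctr x)" "hctr (scal a) = scal (ctr a)"
  by (simp_all add: hctr_def hq_eq_iff)

text \<open>The trace is taken coordinatewise and \<open>lift k\<close> has rational integer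
  coordinates, so it passes through.\<close>

lemma hctr_lift: "hctr (lift k * x) = k * hctr x"
  by (simp add: hctr_def hq_eq_iff hq_mult lift_def flip: of_int_mult)
     (simp add: ctr_def of_int_mult_cub cub_mult algebra_simps)

lemma hctr_scal_lift: "hctr (scal a * lift k) = scal (ctr a) * k"
  by (simp add: hctr_def hq_eq_iff lift_def ctr_def cub_mult algebra_simps)

section \<open>The left module attached to \<alpha> and its Hermitian form\<close>

lemma scal_cancel:
  fixes x y :: "int cub hq"
  assumes "a \<noteq> 0" "scal a * x = scal a * y"
  shows "x = y"
  using assms cub_cancel[OF assms(1)] by (simp add: hq_eq_iff)

text \<open>This is the trace of y times the conjugate of z, divided by \<alpha>. The quotient is
  written with \<open>THE\<close>: it is unique by \<open>scal_cancel\<close> and exists on the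
  lattice by \<open>lcomb_form\<close>.\<close>

definition hform :: "int cub \<Rightarrow> int cub hq \<Rightarrow> int cub hq \<Rightarrow> int hq" where
  "hform \<alpha> y z = hctr (THE q. y * hconj z = scal \<alpha> * q)"

lemma hform_eq:
  assumes "\<alpha> \<noteq> 0" "y * hconj z = scal \<alpha> * q"
  shows "hform \<alpha> y z = hctr q"
proof -
  have "(THE q. y * hconj z = scal \<alpha> * q) = q"
    by (rule the_equality) (use assms scal_cancel in metis)+
  then show ?thesis by (simp add: hform_def)
qed

definition lcomb :: "int cub hq \<Rightarrow> int cub hq \<Rightarrow> int cub hq \<Rightarrow> int cub hq set" where
  "lcomb b0 b1 b2 = {lift k0 * b0 + lift k1 * b1 + lift k2 * b2 |k0 k1 k2. True}"

lemma lcomb_diff: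
  assumes "x \<in> lcomb b0 b1 b2" "y \<in> lcomb b0 b1 b2"
  shows "x - lift k * y \<in> lcomb b0 b1 b2"
proof -
  obtain k0 k1 k2 l0 l1 l2 where
    "x = lift k0 * b0 + lift k1 * b1 + lift k2 * b2" "y = lift l0 * b0 + lift l1 * b1 + lift l2 * b2"
    using assms by (auto simp: lcomb_def)
  then have "x - lift k * y
    = lift (k0 - k * l0) * b0 + lift (k1 - k * l1) * b1 + lift (k2 - k * l2) * b2"
    by (simp add: algebra_simps)
  then show ?thesis unfolding lcomb_def by blast
qed

lemma lcomb_gen: "b0 \<in> lcomb b0 b1 b2" "b1 \<in> lcomb b0 b1 b2" "b2 \<in> lcomb b0 b1 b2"
proof -
  have "b0 = lift 1 * b0 + lift 0 * b1 + lift 0 * b2" "b1 = lift 0 * b0 + lift 1 * b1 + lift 0 * b2"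
    "b2 = lift 0 * b0 + lift 0 * b1 + lift 1 * b2" by simp_all
  then show "b0 \<in> lcomb b0 b1 b2" "b1 \<in> lcomb b0 b1 b2" "b2 \<in> lcomb b0 b1 b2"
    unfolding lcomb_def by blast+
qed

lemma scal_multiple_add:
  assumes "\<exists>q. x = scal \<alpha> * q" "\<exists>q. y = scal \<alpha> * q"
  shows "\<exists>q. x + y = scal \<alpha> * q"
  using assms by (metis distrib_left)

lemma scal_multiple_mult:
  assumes "\<exists>q. x = scal \<alpha> * q"
  shows "\<exists>q. u * x = scal \<alpha> * q" "\<exists>q. x * u = scal \<alpha> * q"
  using assms by (metis scal_left_commute, metis mult.assoc)

lemma scal_multiple_hconj:
  assumes "\<exists>q. x = scal \<alpha> * q"
  shows "\<exists>q. hconj x = scal \<alpha> * q"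
  using assms by (metis hconj_mult hconj_simps(4) scal_commute)

lemma lcomb_form:
  assumes "\<And>x y. x \<in> {b0, b1, b2} \<Longrightarrow> y \<in> {b0, b1, b2} \<Longrightarrow> \<exists>q. x * hconj y = scal \<alpha> * q"
    and "x \<in> lcomb b0 b1 b2" "y \<in> lcomb b0 b1 b2"
  shows "\<exists>q. x * hconj y = scal \<alpha> * q"
proof -
  have 1: "\<exists>q. b * hconj y = scal \<alpha> * q" if b: "b \<in> {b0, b1, b2}" for b
  proof -
    obtain l0 l1 l2 where "y = lift l0 * b0 + lift l1 * b1 + lift l2 * b2"
      using assms(3) by (auto simp: lcomb_def)
    then have *: "b * hconj y = b * hconj b0 * hconj (lift l0) + b * hconj b1 * hconj (lift l1)
        + b * hconj b2 * hconj (lift l2)"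
      by (simp add: algebra_simps)
    show ?thesis unfolding *
      by (intro scal_multiple_add; rule scal_multiple_mult(2); rule assms(1)[OF b]; simp)
  qed
  obtain k0 k1 k2 where "x = lift k0 * b0 + lift k1 * b1 + lift k2 * b2"
    using assms(2) by (auto simp: lcomb_def)
  then have *: "x * hconj y = lift k0 * (b0 * hconj y) + lift k1 * (b1 * hconj y)
      + lift k2 * (b2 * hconj y)"
    by (simp add: algebra_simps)
  show ?thesis unfolding *
    by (intro scal_multiple_add; rule scal_multiple_mult(1); rule 1; simp)
qed

lemma lcomb_lattice:
  assumes "\<alpha> \<noteq> 0"
    and "\<And>x y. x \<in> {b0, b1, b2} \<Longrightarrow> y \<in> {b0, b1, b2} \<Longrightarrow> \<exists>q. x * hconj y = scal \<alpha> * q"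
  shows "hermitian_lattice (lcomb b0 b1 b2) (\<lambda>k. (*) (lift k)) (hform \<alpha>)"
proof
  fix x y z k assume xyz: "x \<in> lcomb b0 b1 b2" "y \<in> lcomb b0 b1 b2"
  show "x - lift k * y \<in> lcomb b0 b1 b2" using xyz by (rule lcomb_diff)
  obtain q where q: "x * hconj y = scal \<alpha> * q" using lcomb_form[OF assms(2)] xyz by metis
  have "y * hconj x = hconj (x * hconj y)" by simp
  also have "\<dots> = scal \<alpha> * hconj q" by (simp only: q) (simp add: scal_commute[of "hconj q"])
  finally show "hform \<alpha> y x = hconj (hform \<alpha> x y)"
    using q by (simp add: hform_eq[OF assms(1)])
next
  fix x y z k assume xyz: "x \<in> lcomb b0 b1 b2" "y \<in> lcomb b0 b1 b2" "z \<in> lcomb b0 b1 b2"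
  obtain q where q: "x * hconj z = scal \<alpha> * q" using lcomb_form[OF assms(2)] xyz by metis
  obtain r where r: "y * hconj z = scal \<alpha> * r" using lcomb_form[OF assms(2)] xyz by metis
  have "(x - lift k * y) * hconj z = scal \<alpha> * (q - lift k * r)"
    by (simp add: algebra_simps q r scal_left_commute)
  then show "hform \<alpha> (x - lift k * y) z = hform \<alpha> x z - k * hform \<alpha> y z"
    using q r by (simp add: hform_eq[OF assms(1)] hctr_lift)
qed

text \<open>Cauchy-Binet for the Gram matrix of (1, 1, 1), (a1, a2, a3), (b1, b2, b3) with weights
  g1, g2, g3.\<close>

lemma weighted_gram_det:
  fixes g1 g2 g3 :: real
  assumes "D = (g1 + g2 + g3) * (g1 * a1\<^sup>2 + g2 * a2\<^sup>2 + g3 * a3\<^sup>2) * (g1 * b1\<^sup>2 + g2 * b2\<^sup>2 + g3 * b3\<^sup>2)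
    + 2 * (g1 * a1 + g2 * a2 + g3 * a3) * (g1 * a1 * b1 + g2 * a2 * b2 + g3 * a3 * b3)
        * (g1 * b1 + g2 * b2 + g3 * b3)
    - (g1 + g2 + g3) * (g1 * a1 * b1 + g2 * a2 * b2 + g3 * a3 * b3)\<^sup>2
    - (g1 * a1\<^sup>2 + g2 * a2\<^sup>2 + g3 * a3\<^sup>2) * (g1 * b1 + g2 * b2 + g3 * b3)\<^sup>2
    - (g1 * b1\<^sup>2 + g2 * b2\<^sup>2 + g3 * b3\<^sup>2) * (g1 * a1 + g2 * a2 + g3 * a3)\<^sup>2"
  shows "D = g1 * g2 * g3 * ((a2 - a1) * (b3 - b1) - (a3 - a1) * (b2 - b1))\<^sup>2"
  unfolding assms by (simp add: algebra_simps power2_eq_square)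

text \<open>The determinant of the conjugates of the basis 1, \<open>e1\<close>, \<open>e2\<close>.
  Its square is the discriminant 49, whatever s, u, v are, because the change from 1, \<theta>,
  \<theta>^2 is unimodular.\<close>

lemma root_discriminant:
  fixes s u v :: int
  defines "e1 \<equiv> Cub s 1 0" and "e2 \<equiv> Cub v u 1"
  shows "(csig e1 - e1) * (csig (csig e2) - e2) - (csig (csig e1) - e1) * (csig e2 - e2) = - 7"
  by (simp add: e1_def e2_def cub_eq_iff cub_mult)

text \<open>The shape of an off-diagonal Gram entry below: the shared right factor \<open>z\<close>
  contributes only its norm.\<close>

lemma scal_shear_product:
  "(scal a * p * z) * hconj (scal b * z) = scal (a * b * hnorm z) * p"
proof -
  have "(scal a * p * z) * hconj (scal b * z) = scal a * p * (z * hconj z) * scal b"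
    by (simp add: mult.assoc)
  also have "\<dots> = scal a * p * scal (hnorm z * b)"
    by (simp only: hconj_right scal_mult mult.assoc)
  also have "\<dots> = scal (hnorm z * b) * (scal a * p)" by (rule scal_commute)
  also have "\<dots> = scal (a * b * hnorm z) * p"
    by (simp flip: mult.assoc scal_mult) (simp add: mult.commute mult.left_commute)
  finally show ?thesis .
qed

lemma scal_triple_product:
  "scal a * x * (scal b * y) * hconj (scal c * (x * y)) = scal (a * b * c * hnorm x * hnorm y)"
proof -
  have "scal a * x * (scal b * y) * hconj (scal c * (x * y))
    = scal a * (scal b * ((x * y) * hconj (x * y)) * scal c)"
    by (simp add: mult.assoc scal_left_commute[of x])
  also have "\<dots> = scal (a * b * c * hnorm x * hnorm y)"
    by (simp only: hconj_right scal_mult[symmetric] hnorm_mult) (simp add: mult_ac)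
  finally show ?thesis .
qed

lemma ctr_eq_evi:
  fixes t :: "'a::{comm_ring_1, ring_char_0}"
  shows "of_int (ctr x) = evi t x + evi t (csig x) + evi t (csig (csig x))"
proof -
  have "evi t (of_int (ctr x)) = evi t (x + csig x + csig (csig x))"
    by (simp only: cub_ctr_int)
  then show ?thesis by simp
qed

lemma evi_hnorm_nonneg:
  fixes t :: real
  assumes "is_root t"
  shows "evi t (hnorm y) \<ge> 0"
proof -
  have "evi t (4 * hnorm y) \<ge> 0"
    unfolding four_hnorm by (simp only: evi_simps evi_power[OF assms]) simp
  then show ?thesis using assms by simp
qed

lemma tpos_factor:
  assumes t: "is_root t" and \<alpha>: "tpos t \<alpha>" and m: "hnorm y = \<alpha> * m" "m \<noteq> 0"
  shows "tpos t m"
proof -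
  have *: "evi t' m > 0" if t': "is_root t'" "evi t' \<alpha> > 0" for t' :: real
  proof -
    have "evi t' \<alpha> * evi t' m \<ge> 0"
      using evi_hnorm_nonneg[OF t'(1), of y] m t' by simp
    moreover have "evi t' m \<noteq> 0" using evi_eq_0_iff t' m by metis
    ultimately show ?thesis using t' by (simp add: zero_le_mult_iff)
  qed
  note r = is_root_sigma(1)[OF t] is_root_sigma(1)[OF is_root_sigma(1)[OF t]]
  show ?thesis
    using \<alpha> *[OF t] *[OF r(1)] *[OF r(2)] t r by (simp add: tpos_def evi_csig)
qed

lemma exists_norm_multiple:
  assumes t: "is_root t" and \<alpha>: "tpos t \<alpha>"
  shows "\<exists>y m. hnorm y = \<alpha> * m \<and> tpos t m \<and> ctr m \<le> 7"
proof -
  have "\<alpha> \<noteq> 0" using \<alpha> by (auto simp: tpos_def)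
  then obtain c n1 n2 s u v s0 s1 s2 where pos: "c > 0" "n1 > 0" "n2 > 0"
    and s0: "\<alpha> * s0 = of_int (c * n1 * n2)" and s1: "\<alpha> * s1 = of_int (c * n1) * Cub s 1 0"
    and s2: "\<alpha> * s2 = of_int c * Cub v u 1" and dvd: "(c * n1 * n2) * (c * n1) * c dvd cnorm \<alpha>"
    by (rule principal_ideal_basis)
  define e1 e2 where "e1 = Cub s 1 0" and "e2 = Cub v u 1"
  note s1 = s1[folded e1_def] and s2 = s2[folded e2_def]
  obtain x2 x1 x0 :: "int hq" where x: "hnorm x2 = c" "hnorm x1 = n1" "hnorm x0 = n2"
    using hnorm_represents pos by metis
  \<comment> \<open>The nested products have norms c n1 n2, c n1 and c, the elementary divisors of
    the ideal. Any two share the shorter product as right factor, so each pairing is divisible by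
    \<alpha>.\<close>
  define b0 b1 b2 where "b0 = lift (x0 * x1 * x2)" and "b1 = scal e1 * lift (x1 * x2)"
    and "b2 = scal e2 * lift x2"
  have p00: "b0 * hconj b0 = scal \<alpha> * scal s0"
    unfolding hconj_right scal_mult[symmetric] s0 by (simp add: b0_def x mult.commute mult.left_commute)
  have p01: "b0 * hconj b1 = scal \<alpha> * (scal s1 * lift x0)"
    using scal_shear_product[of 1 "lift x0" "lift (x1 * x2)" e1]
    by (simp add: b0_def b1_def x mult.assoc[symmetric] flip: scal_mult of_int_mult)
      (simp add: s1 mult.commute)
  have p02: "b0 * hconj b2 = scal \<alpha> * (scal s2 * lift (x0 * x1))"
    using scal_shear_product[of 1 "lift (x0 * x1)" "lift x2" e2]
    by (simp add: b0_def b2_def x mult.assoc[symmetric] flip: scal_mult)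
      (simp add: s2 mult.commute)
  have p11: "b1 * hconj b1 = scal \<alpha> * scal (s1 * e1)"
    unfolding hconj_right scal_mult[symmetric]
    by (simp add: b1_def x s1 power2_eq_square mult.assoc[symmetric])
  have p12: "b1 * hconj b2 = scal \<alpha> * (scal (s2 * e1) * lift x1)"
    using scal_shear_product[of e1 "lift x1" "lift x2" e2]
    by (simp add: b1_def b2_def x mult.assoc[symmetric] flip: scal_mult)
      (simp add: s2 mult.commute mult.left_commute)
  have p22: "b2 * hconj b2 = scal \<alpha> * scal (s2 * e2)"
    unfolding hconj_right scal_mult[symmetric]
    by (simp add: b2_def x s2 power2_eq_square mult.assoc[symmetric])
  define A B C U V W where "A = ctr s0" and "B = ctr (s1 * e1)" and "C = ctr (s2 * e2)"
    and "U = ctr s1" and "V = ctr (s2 * e1)" and "W = ctr s2"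
  note h = hform_eq[OF \<open>\<alpha> \<noteq> 0\<close>]
  have h00: "hform \<alpha> b0 b0 = scal A" and h11: "hform \<alpha> b1 b1 = scal B"
    and h22: "hform \<alpha> b2 b2 = scal C" and h01: "hform \<alpha> b0 b1 = scal U * x0"
    and h12: "hform \<alpha> b1 b2 = scal V * x1" and h02: "hform \<alpha> b0 b2 = scal W * (x0 * x1)"
    using h[OF p00] h[OF p11] h[OF p22] h[OF p01] h[OF p12] h[OF p02]
    by (simp_all only: hctr_simps hctr_scal_lift A_def B_def C_def U_def V_def W_def)
  have mult: "\<exists>q. x * hconj y = scal \<alpha> * q" if "x \<in> {b0, b1, b2}" "y \<in> {b0, b1, b2}" for x y
  proof -
    have "b1 * hconj b0 = hconj (b0 * hconj b1)" "b2 * hconj b0 = hconj (b0 * hconj b2)"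
      "b2 * hconj b1 = hconj (b1 * hconj b2)" by simp_all
    then show ?thesis
      using that scal_multiple_hconj[of _ \<alpha>] p00 p01 p02 p11 p12 p22
      by (elim insertE emptyE) metis+
  qed
  interpret hermitian_lattice "lcomb b0 b1 b2" "\<lambda>k. (*) (lift k)" "hform \<alpha>"
    using \<open>\<alpha> \<noteq> 0\<close> mult by (rule lcomb_lattice)
  define \<alpha>1 \<alpha>2 \<alpha>3 where "\<alpha>1 = evi t \<alpha>" and "\<alpha>2 = evi t (csig \<alpha>)" and "\<alpha>3 = evi t (csig (csig \<alpha>))"
  have \<alpha>_pos: "\<alpha>1 > 0" "\<alpha>2 > 0" "\<alpha>3 > 0"
    using \<alpha> by (simp_all add: tpos_def \<alpha>1_def \<alpha>2_def \<alpha>3_def)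
  \<comment> \<open>Division by \<alpha> becomes weighting the three embeddings by the inverses of
    its conjugates.\<close>
  define g1 g2 g3 where "g1 = 1 / \<alpha>1" and "g2 = 1 / \<alpha>2" and "g3 = 1 / \<alpha>3"
  have g: "g1 > 0" "g2 > 0" "g3 > 0" using \<alpha>_pos by (simp_all add: g1_def g2_def g3_def)
  define a1 a2 a3 where "a1 = evi t e1" and "a2 = evi t (csig e1)" and "a3 = evi t (csig (csig e1))"
  define b1' b2' b3' where "b1' = evi t e2" and "b2' = evi t (csig e2)" and "b3' = evi t (csig (csig e2))"
  have div: "evi t x = of_int n * evi t y * g1" "evi t (csig x) = of_int n * evi t (csig y) * g2"
    "evi t (csig (csig x)) = of_int n * evi t (csig (csig y)) * g3"
    if "\<alpha> * x = of_int n * y" for x y n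
  proof -
    have "evi t (\<alpha> * x) = evi t (of_int n * y)" "evi t (csig (\<alpha> * x)) = evi t (csig (of_int n * y))"
      "evi t (csig (csig (\<alpha> * x))) = evi t (csig (csig (of_int n * y)))"
      by (simp_all only: that)
    then show "evi t x = of_int n * evi t y * g1" "evi t (csig x) = of_int n * evi t (csig y) * g2"
      "evi t (csig (csig x)) = of_int n * evi t (csig (csig y)) * g3"
      using \<alpha>_pos t by (simp_all add: g1_def g2_def g3_def \<alpha>1_def \<alpha>2_def \<alpha>3_def field_simps)
  qed
  have s0': "\<alpha> * s0 = of_int (c * n1 * n2) * 1" using s0 by simp
  have A: "of_int A = of_int (c * n1 * n2) * (g1 + g2 + g3)"
    unfolding A_def ctr_eq_evi[of _ t] using div[OF s0'] by (simp add: algebra_simps)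
  have U: "of_int U = of_int (c * n1) * (g1 * a1 + g2 * a2 + g3 * a3)"
    unfolding U_def ctr_eq_evi[of _ t] using div[OF s1] by (simp add: a1_def a2_def a3_def algebra_simps)
  have W: "of_int W = of_int c * (g1 * b1' + g2 * b2' + g3 * b3')"
    unfolding W_def ctr_eq_evi[of _ t] using div[OF s2] by (simp add: b1'_def b2'_def b3'_def algebra_simps)
  have B: "of_int B = of_int (c * n1) * (g1 * a1\<^sup>2 + g2 * a2\<^sup>2 + g3 * a3\<^sup>2)"
    unfolding B_def ctr_eq_evi[of _ t] using div[OF s1] t
    by (simp add: a1_def a2_def a3_def algebra_simps power2_eq_square)
  have V: "of_int V = of_int c * (g1 * a1 * b1' + g2 * a2 * b2' + g3 * a3 * b3')"
    unfolding V_def ctr_eq_evi[of _ t] using div[OF s2] t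
    by (simp add: a1_def a2_def a3_def b1'_def b2'_def b3'_def algebra_simps)
  have C: "of_int C = of_int c * (g1 * b1'\<^sup>2 + g2 * b2'\<^sup>2 + g3 * b3'\<^sup>2)"
    unfolding C_def ctr_eq_evi[of _ t] using div[OF s2] t
    by (simp add: b1'_def b2'_def b3'_def algebra_simps power2_eq_square)
  define D where "D = hdisc A B C (scal U * x0) (scal V * x1) (scal W * (x0 * x1))"
  have "scal U * x0 * (scal V * x1) * hconj (scal W * (x0 * x1)) = scal (U * V * W * n1 * n2)"
    by (simp only: scal_triple_product x) (simp add: mult_ac)
  then have D: "D = A * B * C + 2 * (U * V * W * n1 * n2) - A * V\<^sup>2 * n1 - B * W\<^sup>2 * (n1 * n2) - C * U\<^sup>2 * n2"
    by (simp add: D_def hdisc_def x htr_def)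
  define E where "E = (a2 - a1) * (b3' - b1') - (a3 - a1) * (b2' - b1')"
  have "E = evi t (- 7)"
    unfolding root_discriminant[of s v u, folded e1_def e2_def, symmetric] using t
    by (simp add: E_def a1_def a2_def a3_def b1'_def b2'_def b3'_def)
  then have E: "E\<^sup>2 = 49" by simp
  \<comment> \<open>The scale factors come out of the Moore determinant, leaving the weighted Gram
    determinant of 1, \<open>e1\<close>, \<open>e2\<close>.\<close>
  have "of_int D = of_int ((c * n1 * n2) * (c * n1) * c) * (g1 * g2 * g3 * E\<^sup>2)"
    unfolding E_def weighted_gram_det[OF refl, symmetric] D of_int_diff of_int_add of_int_mult of_int_power A B C U V W
    by (simp add: algebra_simps power2_eq_square)
  then have D_eq: "of_int D = 49 * (of_int ((c * n1 * n2) * (c * n1) * c) / (\<alpha>1 * \<alpha>2 * \<alpha>3))"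
    by (simp add: E g1_def g2_def g3_def)
  have N: "of_int (cnorm \<alpha>) = \<alpha>1 * \<alpha>2 * \<alpha>3"
  proof -
    have "(of_int (cnorm \<alpha>) :: real) = evi t (\<alpha> * cadj \<alpha>)" by (simp only: cub_adj_int evi_simps)
    then show ?thesis using t by (simp add: cadj_eq \<alpha>1_def \<alpha>2_def \<alpha>3_def)
  qed
  have "(c * n1 * n2) * (c * n1) * c \<le> cnorm \<alpha>"
    using dvd tpos_pos[OF t \<alpha>] by (simp add: zdvd_imp_le)
  then have "real_of_int ((c * n1 * n2) * (c * n1) * c) \<le> \<alpha>1 * \<alpha>2 * \<alpha>3"
    by (simp only: N[symmetric] of_int_le_iff)
  then have "of_int D \<le> (49 :: real)" unfolding D_eq using \<alpha>_pos by (simp add: field_simps)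
  then have D49: "D \<le> 49" by simp
  have "(of_int D :: real) > 0" unfolding D_eq using \<alpha>_pos pos by simp
  then have D_pos: "D > 0" by simp
  have "(of_int A :: real) > 0" unfolding A using g pos by (simp add: add_pos_pos)
  then have A_pos: "A > 0" by simp
  have "evi t (csig e1 - e1) \<noteq> 0"
    unfolding evi_eq_0_iff[OF t] by (simp add: e1_def cub_eq_iff)
  then have "a2 \<noteq> a1" by (simp add: a1_def a2_def)
  \<comment> \<open>The defect in the weighted Cauchy-Schwarz inequality, by Lagrange's identity; it
    is positive because \<open>e1\<close> differs from its conjugate.\<close>
  have "real_of_int (A * B - U\<^sup>2 * n2) = of_int (c * n1 * n2) * of_int (c * n1)
      * (g1 * g2 * (a2 - a1)\<^sup>2 + g1 * g3 * (a3 - a1)\<^sup>2 + g2 * g3 * (a3 - a2)\<^sup>2)"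
    unfolding of_int_diff of_int_mult of_int_power A B U
    by (simp add: algebra_simps power2_eq_square)
  also have "\<dots> > 0"
    using g pos \<open>a2 \<noteq> a1\<close> by (intro mult_pos_pos add_pos_nonneg) auto
  finally have d_pos: "A * B - hnorm (scal U * x0) > 0" by (simp only: hnorm_mult hnorm_scal x of_int_0_less_iff)
  obtain y m' where y: "y \<in> lcomb b0 b1 b2" "hform \<alpha> y y = scal m'" "0 < m'" "m' ^ 3 \<le> 8 * D"
    using exists_short_vector[OF lcomb_gen h00 h11 h22 A_pos, unfolded h01 h12 h02, OF d_pos D_def[symmetric] D_pos]
    by blast
  obtain q where q: "y * hconj y = scal \<alpha> * q" using lcomb_form[OF mult] y by metis
  define m where "m = hq1 q"
  have m: "hnorm y = \<alpha> * m" using q by (simp add: hconj_right m_def hq_eq_iff)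
  have "hctr q = scal m'" using h[OF q] y by simp
  then have m': "ctr m = m'" by (simp add: m_def hctr_def hq_eq_iff)
  then have "m \<noteq> 0" using y(3) by (metis ctr_simps(1) less_irrefl)
  then have "tpos t m" by (rule tpos_factor[OF t \<alpha> m])
  moreover have "m' \<le> 7"
  proof (rule ccontr)
    assume "\<not> m' \<le> 7"
    \<comment> \<open>The cube is at most 8 * 49 = 392 < 512 = 8^3.\<close>
    then have "8 ^ 3 \<le> m' ^ 3" by (intro power_mono) auto
    then show False using y D49 by simp
  qed
  ultimately show ?thesis using m m' by metis
qed

section \<open>The primes 2 and 7\<close>

text \<open>\<open>X\<^sup>2 + X + 1\<close> has no root in the field with 8 elements.\<close>

lemma two_dvd_binary_form:
  fixes a s :: "int cub"
  assumes "2 dvd a * a + s * a + s * s"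
  shows "2 dvd a" "2 dvd s"
proof -
  have "(even (cf0 a) \<and> even (cf1 a) \<and> even (cf2 a)) \<and> (even (cf0 s) \<and> even (cf1 s) \<and> even (cf2 s))"
    using assms unfolding two_dvd_cub_iff
    by (cases "even (cf0 a)"; cases "even (cf1 a)"; cases "even (cf2 a)";
        cases "even (cf0 s)"; cases "even (cf1 s)"; cases "even (cf2 s)"; simp add: cub_mult)
  then show "2 dvd a" "2 dvd s" by (simp_all add: two_dvd_cub_iff)
qed

lemma hnorm_half:
  fixes y :: "int cub hq"
  assumes "hnorm y = a * 2"
  shows "\<exists>y' :: int cub hq. hnorm y' = a"
proof -
  obtain p q r s where y: "y = HQ p q r s" by (cases y)
  define b where "b = p + q + r"
  \<comment> \<open>Modulo 2 the quaternary norm depends only on p + q + r and s, through an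
    anisotropic binary form.\<close>
  have "b * b + s * b + s * s = hnorm y + 2 * (p * q + p * r + q * r)"
    by (simp add: y b_def hnorm_def algebra_simps power2_eq_square)
  also have "\<dots> = 2 * (a + p * q + p * r + q * r)" using assms by (simp add: algebra_simps)
  finally have *: "2 dvd b * b + s * b + s * s" by simp
  obtain b' s' where b': "b = 2 * b'" and s': "s = 2 * s'"
    using two_dvd_binary_form[OF *] by blast
  have q: "q = 2 * b' - p - r" using b' by (simp add: b_def algebra_simps)
  \<comment> \<open>The witness is (1 - i) y / 2, the left quotient of \<open>y\<close> by 1 +
    i.\<close>
  have "2 * hnorm (HQ (b' + s') (b' - p) (r + s') (- r)) = hnorm y"
    by (simp add: y q s' hnorm_def algebra_simps power2_eq_square)
  then have "2 * hnorm (HQ (b' + s') (b' - p) (r + s') (- r)) = 2 * a" using assms by (simp add: mult.commute)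
  then have "hnorm (HQ (b' + s') (b' - p) (r + s') (- r)) = a"
    by (rule cub_cancel[rotated]) (simp add: cub_eq_iff)
  then show ?thesis by blast
qed

text \<open>Reduction modulo the prime \<open>2 - \<theta>\<close> of norm 7.\<close>

definition at2 :: "int cub \<Rightarrow> int" where "at2 x = cf0 x + 2 * cf1 x + 4 * cf2 x"

text \<open>The minimal polynomial takes the value 7 at 2, so \<theta> \<mapsto> 2 identifies the
  quotient by 2 - \<theta> with the integers modulo 7.\<close>

lemma dvd_iff_at2: "Cub 2 (-1) 0 dvd x \<longleftrightarrow> 7 dvd at2 x"
proof
  assume "7 dvd at2 x"
  then obtain k where k: "at2 x = 7 * k" ..
  have "x = Cub 2 (-1) 0 * Cub (4 * k - 2 * cf2 x - cf1 x) (3 * k - cf2 x) k"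
    using k by (simp add: cub_eq_iff cub_mult at2_def algebra_simps)
  then show "Cub 2 (-1) 0 dvd x" by (metis dvd_triv_left)
next
  assume "Cub 2 (-1) 0 dvd x"
  then obtain z where "x = Cub 2 (-1) 0 * z" ..
  then have "at2 x = 7 * cf2 z" by (simp add: at2_def cub_mult)
  then show "7 dvd at2 x" by simp
qed

lemma reduce_at2:
  "\<exists>r. y = lift (map_hq at2 y) + scal (Cub 2 (-1) 0) * r"
proof -
  \<comment> \<open>The polynomial quotient of x - x(2) by 2 - \<theta>, where x(2) is
    \<open>at2 x\<close>.\<close>
  define d where "d x = Cub (- cf1 x - 2 * cf2 x) (- cf2 x) 0" for x :: "int cub"
  have "x = of_int (at2 x) + Cub 2 (-1) 0 * d x" for x
    by (simp add: cub_eq_iff cub_mult at2_def d_def)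
  then have "y = lift (map_hq at2 y) + scal (Cub 2 (-1) 0) * map_hq d y"
    by (simp add: hq_eq_iff lift_def)
  then show ?thesis by blast
qed

lemma hnorm_add: "hnorm (x + y) = hnorm x + hnorm y + htr (x * hconj y)"
  by (simp add: hnorm_def htr_def hq_mult algebra_simps power2_eq_square)

lemma hnorm_add_scal:
  "hnorm (x + scal a * y) = hnorm x + a * (a * hnorm y + htr (x * hconj y))"
  by (simp add: hnorm_add scal_commute[of "hconj y"] scal_left_commute power2_eq_square
      distrib_left mult.assoc)

lemma dvd_hnorm_at2:
  assumes "Cub 2 (-1) 0 dvd hnorm y"
  shows "7 dvd hnorm (map_hq at2 y)"
proof -
  obtain r where r: "y = lift (map_hq at2 y) + scal (Cub 2 (-1) 0) * r"
    using reduce_at2 by blast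
  have "hnorm y = of_int (hnorm (map_hq at2 y)) + Cub 2 (-1) 0
      * (Cub 2 (-1) 0 * hnorm r + htr (lift (map_hq at2 y) * hconj r))"
    by (subst r) (simp only: hnorm_add_scal hnorm_lift)
  then have "Cub 2 (-1) 0 dvd (of_int (hnorm (map_hq at2 y)) :: int cub)"
    using assms by (metis dvd_add_left_iff dvd_triv_left)
  then show ?thesis by (simp add: dvd_iff_at2) (simp add: at2_def)
qed

text \<open>One quaternion of norm \<open>2 - \<theta>\<close> for each of the eight left ideals of reduced norm \<open>(2 - \<theta>)\<close>.\<close>

definition norm_pi :: "int cub hq list" where
  "norm_pi = [HQ (Cub (-1) 0 0) 0 0 (Cub (-1) 0 1), HQ 0 (Cub (-1) 0 1) 0 (Cub (-1) 0 0),
     HQ (Cub (-1) 0 0) (Cub (-1) 0 0) (Cub (-1) 0 0) (Cub 0 0 1),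
     HQ 0 0 (Cub (-1) 0 0) (Cub (-1) 0 1), HQ 0 0 (Cub (-1) 0 1) (Cub (-1) 0 0),
     HQ (Cub (-1) 0 1) 0 (Cub 1 0 0) (Cub (-1) 0 0), HQ 0 (Cub (-1) 0 0) 0 (Cub (-1) 0 1),
     HQ (Cub (-1) 0 1) 0 0 (Cub (-1) 0 0)]"

definition norm_pi_at2 :: "int hq list" where
  "norm_pi_at2 = [HQ (-1) 0 0 3, HQ 0 3 0 (-1), HQ (-1) (-1) (-1) 4, HQ 0 0 (-1) 3,
     HQ 0 0 3 (-1), HQ 3 0 1 (-1), HQ 0 (-1) 0 3, HQ 3 0 0 (-1)]"

lemma norm_pi_at2: "map (map_hq at2) norm_pi = norm_pi_at2"
  by (simp add: norm_pi_def norm_pi_at2_def at2_def)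

lemma hnorm_norm_pi:
  assumes "z \<in> set norm_pi"
  shows "hnorm z = Cub 2 (-1) 0"
  using assms by (auto simp: norm_pi_def hnorm_def cub_eq_iff cub_mult power2_eq_square)

definition dvd7 :: "int hq \<Rightarrow> bool" where
  "dvd7 x \<longleftrightarrow> hq1 x mod 7 = 0 \<and> hqi x mod 7 = 0 \<and> hqj x mod 7 = 0 \<and> hqw x mod 7 = 0"

definition norm_pi_check :: "int \<Rightarrow> int \<Rightarrow> int \<Rightarrow> int \<Rightarrow> bool" where
  "norm_pi_check p q r s \<longleftrightarrow> ((p * p + q * q + r * r + s * s + s * (p + q + r)) mod 7 = 0 \<longrightarrow>
     list_ex (\<lambda>z. dvd7 (hconj z * HQ p q r s)) norm_pi_at2)"

text \<open>Modulo 7 the Hurwitz order is the ring of 2 by 2 matrices over the field with 7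
  elements. The condition says that the column space of a singular matrix lies in that of
  \<open>z\<close>, and the list realises all eight lines of the plane.\<close>

lemma norm_pi_table:
  "\<forall>p\<in>set [0..6]. \<forall>q\<in>set [0..6]. \<forall>r\<in>set [0..6]. \<forall>s\<in>set [0..6]. norm_pi_check p q r s"
  by code_simp

lemma norm_pi_covers:
  assumes "7 dvd hnorm x"
  shows "\<exists>z\<in>set norm_pi_at2. \<exists>w. hconj z * x = scal 7 * w"
proof -
  define p q r s where "p = hq1 x mod 7" and "q = hqi x mod 7" and "r = hqj x mod 7" and "s = hqw x mod 7"
  obtain k where x: "x = HQ p q r s + scal 7 * k"
  proof
    show "x = HQ p q r s + scal 7 * HQ (hq1 x div 7) (hqi x div 7) (hqj x div 7) (hqw x div 7)"
      by (simp add: hq_eq_iff p_def q_def r_def s_def)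
  qed
  have "hnorm x = hnorm (HQ p q r s) + 7 * (7 * hnorm k + htr (HQ p q r s * hconj k))"
    by (simp only: x hnorm_add_scal)
  then have "7 dvd hnorm (HQ p q r s)" using assms by (metis dvd_add_left_iff dvd_triv_left)
  then have "(p * p + q * q + r * r + s * s + s * (p + q + r)) mod 7 = 0"
    by (simp add: hnorm_def power2_eq_square)
  moreover have "norm_pi_check p q r s"
    using norm_pi_table by (simp add: p_def q_def r_def s_def del: upto.simps)
  ultimately obtain z where z: "z \<in> set norm_pi_at2" "dvd7 (hconj z * HQ p q r s)"
    unfolding norm_pi_check_def list_ex_iff by metis
  then obtain w where "hconj z * HQ p q r s = scal 7 * w"
    unfolding dvd7_def using scal_dvd_iff[of "hconj z * HQ p q r s" 7] by (auto simp: dvd_eq_mod_eq_0)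
  then have "hconj z * x = scal 7 * (w + hconj z * k)"
    by (simp add: x algebra_simps scal_left_commute)
  then show ?thesis using z by blast
qed

text \<open>Some \<open>v\<close> of norm \<pi> makes the conjugate of v times y divisible by \<pi>;
  the quotient has norm \<pi> (a \<pi>) / \<pi>^2 = a.\<close>

lemma hnorm_divide_pi:
  fixes y :: "int cub hq"
  assumes "hnorm y = a * Cub 2 (-1) 0"
  shows "\<exists>y' :: int cub hq. hnorm y' = a"
proof -
  define \<pi> :: "int cub" where "\<pi> = Cub 2 (-1) 0"
  have "7 dvd hnorm (map_hq at2 y)" by (rule dvd_hnorm_at2) (simp add: assms)
  then obtain z w where z: "z \<in> set norm_pi_at2" "hconj z * map_hq at2 y = scal 7 * w"
    using norm_pi_covers by blast
  obtain v where v: "v \<in> set norm_pi" "z = map_hq at2 v"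
    using z(1) unfolding norm_pi_at2[symmetric] by auto
  obtain r where r: "y = lift (map_hq at2 y) + scal \<pi> * r"
    using reduce_at2 unfolding \<pi>_def by blast
  obtain r' where r': "v = lift z + scal \<pi> * r'"
    using reduce_at2 unfolding \<pi>_def v(2) by blast
  \<comment> \<open>As \<pi> divides 7, the congruence modulo 7 from the table descends to one
    modulo \<pi>.\<close>
  obtain e where e: "(7 :: int cub) = \<pi> * e"
    using dvd_iff_at2[of 7] by (auto simp: at2_def \<pi>_def elim: dvdE)
  have "hconj v * y = hconj (lift z) * y + scal \<pi> * (hconj r' * y)"
    by (simp add: r' distrib_right scal_commute[of "hconj r'"] mult.assoc)
  also have "hconj (lift z) * y = lift (hconj z * map_hq at2 y) + scal \<pi> * (hconj (lift z) * r)"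
    by (subst r) (simp add: distrib_left scal_left_commute)
  also have "lift (hconj z * map_hq at2 y) = scal \<pi> * (scal e * lift w)"
    by (simp add: z(2) e scal_mult mult.assoc)
  finally have "hconj v * y = scal \<pi> * (scal e * lift w + hconj (lift z) * r + hconj r' * y)"
    by (simp add: distrib_left)
  then obtain y' where "hconj v * y = scal \<pi> * y'" ..
  then have "hnorm (hconj v * y) = hnorm (scal \<pi> * y')" by simp
  then have "(\<pi> * \<pi>) * hnorm y' = (\<pi> * \<pi>) * a"
    using assms hnorm_norm_pi[OF v(1)] by (simp add: \<pi>_def power2_eq_square mult_ac)
  then have "hnorm y' = a"
    by (rule cub_cancel[rotated]) (simp add: \<pi>_def cub_eq_iff cub_mult)
  then show ?thesis by blast
qed

lemma tpos_represented:
  assumes t: "is_root t" and \<alpha>: "tpos t \<alpha>"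
  shows "\<exists>y. hnorm y = \<alpha>"
proof -
  obtain y m where ym: "hnorm y = \<alpha> * m" "tpos t m" "ctr m \<le> 7"
    using exists_norm_multiple[OF assms] by blast
  obtain u v k where k: "u * v = 1" "m = u * u * k" "k = 1 \<or> k = 2 \<or> k = Cub 2 (-1) 0"
    using small_trace_cases[of m] tpos_pos[OF t ym(2)] ym(3) by blast
  \<comment> \<open>Multiplying by the inverse unit \<open>v\<close> removes the square u^2 from the
    norm.\<close>
  have "hnorm (scal v * y) = \<alpha> * k * ((u * v) * (u * v))"
    by (simp add: ym k(2) power2_eq_square mult_ac)
  then have *: "hnorm (scal v * y) = \<alpha> * k" by (simp only: k(1) mult_1_right)
  from k(3) show ?thesis
  proof (elim disjE)
    assume "k = 1"
    then show ?thesis using * by (metis mult_1_right)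
  next
    assume "k = 2"
    then show ?thesis using * hnorm_half by blast
  next
    assume "k = Cub 2 (-1) 0"
    then show ?thesis using * hnorm_divide_pi by blast
  qed
qed

section \<open>The ring of integers\<close>

definition evr :: "'a::field_char_0 \<Rightarrow> rat cub \<Rightarrow> 'a" where
  "evr t x = ev t (map_cub of_rat x)"

lemma map_cub_of_rat_hom [simp]:
  "map_cub of_rat 0 = 0" "map_cub of_rat 1 = 1"
  "map_cub of_rat (x + y) = map_cub of_rat x + map_cub of_rat y"
  "map_cub of_rat (- x) = - map_cub of_rat x"
  "map_cub of_rat (x * y) = map_cub of_rat x * map_cub of_rat y"
  by (simp_all add: cub_eq_iff cub_mult of_rat_add of_rat_diff of_rat_mult of_rat_minus)

lemma evr_simps [simp]:
  "evr t 0 = 0" "evr t 1 = 1" "evr t (x + y) = evr t x + evr t y" "evr t (- x) = - evr t x"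
  by (simp_all add: evr_def)

lemma evr_mult [simp]: "is_root t \<Longrightarrow> evr t (x * y) = evr t x * evr t y"
  by (simp add: evr_def)

lemma evr_power [simp]: "is_root t \<Longrightarrow> evr t (x ^ n) = evr t x ^ n"
  by (induction n) simp_all

lemma evr_of_int: "evr t (map_cub of_int x) = evi t x"
  by (simp add: evr_def evi_def ev_def)

lemma evr_const: "evr t (Cub r 0 0) = of_rat r"
  by (simp add: evr_def ev_def)

lemma clear_denominators:
  fixes x :: "rat cub"
  obtains d y where "d > 0" "of_int d * x = map_cub of_int y"
proof -
  have "\<exists>a b. b > 0 \<and> q = of_int a / of_int b" for q :: rat
    by (metis quotient_of_denom_pos' quotient_of_div surjective_pairing)
  then obtain f g where fg: "g q > 0" "q = of_int (f q) / of_int (g q)" for q :: rat by metis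
  then have fg': "q * of_int (g q) = of_int (f q)" for q :: rat
    by (metis eq_divide_eq less_irrefl of_int_eq_0_iff)
  define a b c where "a = cf0 x" and "b = cf1 x" and "c = cf2 x"
  have "of_int (g a * g b * g c) * x
    = map_cub of_int (Cub (f a * g b * g c) (f b * g a * g c) (f c * g a * g b))"
    using fg'[of a] fg'[of b] fg'[of c]
    by (simp add: cub_eq_iff of_int_mult_cub flip: a_def b_def c_def of_int_mult)
      (simp add: mult_ac flip: fg')
  moreover have "g a * g b * g c > 0" using fg by simp
  ultimately show ?thesis using that by blast
qed

lemma map_cub_of_int_eq_0_iff:
  "map_cub of_int x = (0 :: 'a::{comm_ring_1,ring_char_0} cub) \<longleftrightarrow> x = 0"
  by (simp add: cub_eq_iff)

lemma rat_cub_inverse: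
  fixes x :: "rat cub"
  assumes "x \<noteq> 0"
  shows "\<exists>y. x * y = 1"
proof -
  obtain d y where d: "d > 0" "of_int d * x = map_cub of_int y" by (rule clear_denominators)
  have "y \<noteq> 0"
  proof
    assume "y = 0"
    then have "of_int d * x = 0" using d by simp
    then show False using d(1) assms by (simp add: cub_eq_iff of_int_mult_cub)
  qed
  define n where "n = cnorm y"
  have n: "n \<noteq> 0" using \<open>y \<noteq> 0\<close> by (simp add: n_def cnorm_eq_0_iff)
  have "of_int d * x * map_cub of_int (cadj y) = map_cub of_int (y * cadj y)" by (simp add: d)
  also have "\<dots> = of_int n" by (simp only: cub_adj_int n_def map_cub_of_int_hom)
  finally have eq: "of_int d * x * map_cub of_int (cadj y) = of_int n" .
  have "x * (of_int d * map_cub of_int (cadj y) * Cub (1 / of_int n) 0 0)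
      = of_int d * x * map_cub of_int (cadj y) * Cub (1 / of_int n) 0 0"
    by (simp only: mult_ac)
  also have "\<dots> = of_int n * Cub (1 / of_int n) 0 0" by (simp only: eq)
  also have "\<dots> = 1" using n by (simp add: cub_eq_iff of_int_mult_cub)
  finally show ?thesis by blast
qed

lemma evr_eq_0_iff:
  assumes "is_root t"
  shows "evr t x = 0 \<longleftrightarrow> x = 0"
proof
  assume "evr t x = 0"
  show "x = 0"
  proof (rule ccontr)
    assume "x \<noteq> 0"
    then obtain y where "x * y = 1" using rat_cub_inverse by blast
    then have "evr t (x * y) = 1" by simp
    then show False using assms \<open>evr t x = 0\<close> by simp
  qed
qed simp

lemma evr_inject:
  assumes "is_root t" "evr t x = evr t y"
  shows "x = y"
proof -
  have "evr t (x + - y) = 0" using assms(2) by (simp only: evr_simps) simp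
  then show ?thesis using evr_eq_0_iff[OF assms(1)] by (simp add: cub_eq_iff)
qed

text \<open>If b is the reduced denominator of \<open>q\<close>, then b^n divides \<open>c\<close>
  for every n, forcing b = 1.\<close>

lemma rat_bounded_denominators:
  fixes q :: rat
  assumes "c \<noteq> 0" "\<And>n. of_int c * q ^ n \<in> \<int>"
  shows "q \<in> \<int>"
proof -
  obtain a b where ab: "quotient_of q = (a, b)" by force
  have q: "q = of_int a / of_int b" "b > 0" "coprime a b"
    using ab by (simp_all add: quotient_of_div quotient_of_denom_pos quotient_of_coprime)
  have "b ^ n dvd c" for n
  proof -
    obtain m where "of_int c * q ^ n = of_int m" using assms(2)[of n] by (auto elim: Ints_cases)
    then have "(of_int (c * a ^ n) :: rat) = of_int (m * b ^ n)"
      using q(2) by (simp add: q(1) power_divide field_simps)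
    then have "c * a ^ n = m * b ^ n" by (simp only: of_int_eq_iff)
    then have "b ^ n dvd c * a ^ n" by simp
    moreover have "coprime (b ^ n) (a ^ n)" using q(3) by (simp add: coprime_commute)
    ultimately show ?thesis by (simp add: coprime_dvd_mult_left_iff)
  qed
  then have *: "b ^ n \<le> \<bar>c\<bar>" for n
    using assms(1) by (meson dvd_abs_iff zdvd_imp_le zero_less_abs_iff)
  have "b = 1"
  proof (rule ccontr)
    assume "b \<noteq> 1"
    then have "b \<ge> 2" using q by simp
    then have "2 ^ nat \<bar>c\<bar> \<le> b ^ nat \<bar>c\<bar>" by (intro power_mono) auto
    also have "\<dots> \<le> \<bar>c\<bar>" by (rule *)
    also have "\<bar>c\<bar> < 2 ^ nat \<bar>c\<bar>"
      using less_exp[of "nat \<bar>c\<bar>"] by (metis abs_ge_zero int_nat_eq of_nat_less_iff of_nat_numeral of_nat_power)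
    finally show False by simp
  qed
  then show ?thesis using q by simp
qed

lemma range_of_int_closed:
  fixes x y :: "rat cub"
  assumes "x \<in> range (map_cub of_int)" "y \<in> range (map_cub of_int)"
  shows "x + y \<in> range (map_cub of_int)" "x * y \<in> range (map_cub of_int)"
    "- x \<in> range (map_cub of_int)"
  using assms by (auto intro!: rangeI simp flip: map_cub_of_int_hom)

lemma range_of_int_of_int: "(of_int n :: rat cub) \<in> range (map_cub of_int)"
  by (metis map_cub_of_int_hom(7) rangeI)

lemma range_of_int_power:
  "(x :: rat cub) \<in> range (map_cub of_int) \<Longrightarrow> x ^ n \<in> range (map_cub of_int)"
  using range_of_int_of_int[of 1] by (induction n) (auto intro!: range_of_int_closed simp del: map_cub_of_int_hom)

lemma range_of_int_sum:
  assumes "\<And>i. i \<in> A \<Longrightarrow> (f i :: rat cub) \<in> range (map_cub of_int)"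
  shows "sum f A \<in> range (map_cub of_int)"
  using assms range_of_int_of_int[of 0]
  by (induction A rule: infinite_finite_induct) (auto intro!: range_of_int_closed simp del: map_cub_of_int_hom)

lemma evr_sum: "evr t (sum f A) = (\<Sum>i\<in>A. evr t (f i))"
  by (induction A rule: infinite_finite_induct) simp_all

lemma evr_int: "evr t (of_int n) = of_int n"
  using evr_of_int[of t "of_int n"] by simp

text \<open>With D clearing the denominators of \<open>x\<close> and k the degree of a monic
  equation, D^k works: powers below k are immediate, and higher ones reduce to lower ones by the
  equation.\<close>

lemma bounded_denominators:
  fixes x :: "rat cub"
  assumes t: "is_root t" and "algebraic_int (evr t x)"
  shows "\<exists>d>0. \<forall>n. of_int d * x ^ n \<in> range (map_cub of_int)"
proof -
  obtain p where p: "poly (map_poly of_int p) (evr t x) = 0" "lead_coeff p = 1"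
    using assms(2) algebraic_int_altdef_ipoly by blast
  define k where "k = Polynomial.degree p"
  have "poly (map_poly of_int p) (evr t x) = (\<Sum>i\<le>k. of_int (poly.coeff p i) * evr t x ^ i)"
    by (simp add: poly_altdef k_def degree_map_poly coeff_map_poly)
  also have "\<dots> = evr t (\<Sum>i\<le>k. of_int (poly.coeff p i) * x ^ i)"
    using t by (simp add: evr_sum evr_int)
  finally have "(\<Sum>i\<le>k. of_int (poly.coeff p i) * x ^ i) = 0" using p evr_eq_0_iff[OF t] by metis
  then have xk: "x ^ k = - (\<Sum>i<k. of_int (poly.coeff p i) * x ^ i)"
    using p(2) by (simp add: k_def lessThan_Suc_atMost[symmetric] add_eq_0_iff2)
  obtain D y where D: "D > 0" "of_int D * x = map_cub of_int y" by (rule clear_denominators)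
  have "of_int (D ^ k) * x ^ n \<in> range (map_cub of_int)" for n
  proof (induction n rule: less_induct)
    case (less n)
    show ?case
    proof (cases "n < k")
      case True
      then have "of_int (D ^ k) * x ^ n = of_int (D ^ (k - n)) * (of_int D * x) ^ n"
        by (simp add: power_mult_distrib mult.assoc[symmetric] flip: power_add)
      then show ?thesis
        using range_of_int_closed(2)[OF range_of_int_of_int range_of_int_power] D by (metis rangeI)
    next
      case False
      then have "of_int (D ^ k) * x ^ n = of_int (D ^ k) * (x ^ (n - k) * x ^ k)"
        by (simp flip: power_add)
      also have "\<dots> = - (\<Sum>i<k. of_int (poly.coeff p i) * (of_int (D ^ k) * x ^ (n - k + i)))"
        unfolding xk by (simp add: sum_distrib_left sum_negf power_add mult_ac)
      also have "\<dots> \<in> range (map_cub of_int)"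
        using False by (intro range_of_int_closed(3) range_of_int_sum range_of_int_closed(2)
            range_of_int_of_int less.IH) auto
      finally show ?thesis .
    qed
  qed
  then show ?thesis using D(1) by (intro exI[of _ "D ^ k"]) auto
qed

lemma cnorm_of_int [simp]: "cnorm (of_int n) = of_int n ^ 3"
  by (simp add: cnorm_def)

lemma cnorm_power: "cnorm (x ^ n) = cnorm x ^ n"
  by (induction n) (simp_all add: cnorm_def[of 1])

lemma cnorm_map: "cnorm (map_cub of_int x) = of_int (cnorm x)"
  by (simp add: cnorm_def Let_def)

text \<open>By the binomial theorem the powers of a + b x keep the common denominator
  \<open>d\<close>, so all powers of the norm have denominator dividing d^3.\<close>

lemma cnorm_Ints:
  fixes x :: "rat cub"
  assumes d: "d > 0" "\<forall>n. of_int d * x ^ n \<in> range (map_cub of_int)"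
  shows "cnorm (map_cub of_int a + map_cub of_int b * x) \<in> \<int>"
proof -
  define y where "y = map_cub of_int b * x + map_cub of_int a"
  have "of_int d * y ^ n \<in> range (map_cub of_int)" for n
  proof -
    define A B where "A = (map_cub of_int a :: rat cub)" and "B = (map_cub of_int b :: rat cub)"
    have AB: "A \<in> range (map_cub of_int)" "B \<in> range (map_cub of_int)"
      unfolding A_def B_def by (rule rangeI)+
    have "of_int d * y ^ n
        = (\<Sum>i\<le>n. (of_int (int (n choose i)) * (B ^ i * A ^ (n - i))) * (of_int d * x ^ i))"
      unfolding y_def A_def[symmetric] B_def[symmetric] binomial_ring sum_distrib_left
      by (intro sum.cong) (simp_all add: power_mult_distrib mult_ac)
    also have "\<dots> \<in> range (map_cub of_int)"
      by (rule range_of_int_sum, rule range_of_int_closed(2)[OF range_of_int_closed(2)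
            [OF range_of_int_of_int range_of_int_closed(2)[OF range_of_int_power range_of_int_power]]
            spec[OF d(2)]]) (rule AB)+
    finally show ?thesis .
  qed
  then have "cnorm (of_int d * y ^ n) \<in> \<int>" for n
    using cnorm_map by (metis Ints_of_int imageE)
  then have *: "of_int (d ^ 3) * cnorm y ^ n \<in> \<int>" for n by (simp add: cnorm_power)
  have "d ^ 3 \<noteq> 0" using d(1) by simp
  then have "cnorm y \<in> \<int>" using * by (rule rat_bounded_denominators)
  then show ?thesis by (simp add: y_def add.commute)
qed

text \<open>The norm is multiplicative and so accessible to \<open>cnorm_Ints\<close>; the trace is
  recovered from N(y + 1) + N(y - 1) - 2 N(y) = 2 Tr(y).\<close>

lemma two_ctr_Ints:
  fixes x :: "rat cub"
  assumes d: "d > 0" "\<forall>n. of_int d * x ^ n \<in> range (map_cub of_int)"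
  shows "2 * ctr (map_cub of_int b * x) \<in> \<int>"
proof -
  define y where "y = map_cub of_int b * x"
  have "cnorm (map_cub of_int 1 + y) \<in> \<int>" "cnorm (map_cub of_int (- 1) + y) \<in> \<int>"
    "cnorm (map_cub of_int 0 + y) \<in> \<int>"
    unfolding y_def by (rule cnorm_Ints[OF d])+
  moreover have "2 * ctr y = cnorm (map_cub of_int 1 + y) + cnorm (map_cub of_int (- 1) + y)
      - 2 * cnorm (map_cub of_int 0 + y)"
    by (simp add: cnorm_def ctr_def Let_def algebra_simps power2_eq_square power3_eq_cube)
  ultimately show ?thesis unfolding y_def by (metis Ints_add Ints_diff Ints_mult Ints_numeral)
qed

text \<open>Total ramification: all three conjugates agree modulo the prime above 7, so the norm is
  congruent to the cube of \<open>at2 x\<close>.\<close>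

lemma seven_dvd_cnorm:
  fixes x :: "int cub"
  assumes "7 dvd cnorm x"
  shows "Cub 2 (-1) 0 dvd x"
proof -
  define a b c where "a = cf0 x" and "b = cf1 x" and "c = cf2 x"
  have "at2 x ^ 3 = cnorm x + 7 * (b ^ 3 + 9 * c ^ 3 + a\<^sup>2 * b + a\<^sup>2 * c + 2 * a * b\<^sup>2 + 6 * a * c\<^sup>2
      + 7 * b\<^sup>2 * c + 14 * b * c\<^sup>2 + 7 * a * b * c)"
    unfolding at2_def cnorm_def Let_def a_def[symmetric] b_def[symmetric] c_def[symmetric]
    by (simp add: algebra_simps power2_eq_square power3_eq_cube)
  then have "7 dvd at2 x ^ 3" using assms by simp
  moreover have "prime (7 :: int)" by simp
  ultimately have "7 dvd at2 x" using prime_dvd_power by blast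
  then show ?thesis by (simp add: dvd_iff_at2)
qed

text \<open>The trace pairings \<open>T\<^sub>j = Tr(x \<theta>\<^sup>j)\<close> determine \<open>f'(\<theta>) x = \<Sum>j. T\<^sub>j b\<^sub>j\<close>, where
  \<open>f(X)/(X - \<theta>) = \<Sum>j. b\<^sub>j X\<^sup>j\<close>; and \<open>(2 \<theta>\<^sup>2 - 3) f'(\<theta>) = (2 - \<theta>)\<^sup>2\<close>. Since 7 is totally ramified, divisibility by the prime
  \<open>2 - \<theta>\<close> can be read off from norms.\<close>

lemma integral_coordinates:
  fixes x :: "rat cub"
  assumes t: "is_root t" and "algebraic_int (evr t x)"
  shows "x \<in> range (map_cub of_int)"
proof -
  obtain d where d: "d > 0" "\<forall>n. of_int d * x ^ n \<in> range (map_cub of_int)"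
    using bounded_denominators[OF assms] by blast
  define \<pi> :: "int cub" where "\<pi> = Cub 2 (-1) 0"
  have "2 * ctr (map_cub of_int 1 * x) \<in> \<int>" "2 * ctr (map_cub of_int (Cub 0 1 0) * x) \<in> \<int>"
    "2 * ctr (map_cub of_int (Cub 0 0 1) * x) \<in> \<int>"
    by (rule two_ctr_Ints[OF d])+
  then obtain u v w where "2 * ctr x = of_int u" "2 * ctr (Cub 0 1 0 * x) = of_int v"
    "2 * ctr (Cub 0 0 1 * x) = of_int w" by (auto elim!: Ints_cases)
  then have uvw: "of_int u = 2 * (3 * cf0 x - cf1 x + 5 * cf2 x)"
      "of_int v = 2 * (- cf0 x + 5 * cf1 x - 4 * cf2 x)"
      "of_int w = 2 * (5 * cf0 x - 4 * cf1 x + 13 * cf2 x)"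
    by (simp_all add: ctr_def cub_mult)
  \<comment> \<open>The three elements multiplying u, v, w are the b_j, and the first factor is 2
    \<theta>^2 - 3. As u, v, w are doubled traces, the result is 2 \<pi>^2 x.\<close>
  define \<beta> :: "int cub" where "\<beta> = Cub (-3) 0 2 * (of_int u * Cub (-2) 1 1 + of_int v * Cub 1 1 0 + of_int w)"
  have \<beta>: "map_cub of_int \<beta> = map_cub of_int (2 * \<pi> * \<pi>) * x"
    by (simp add: \<beta>_def \<pi>_def cub_eq_iff cub_mult uvw algebra_simps)
  obtain N where N: "cnorm x = of_int N"
    using cnorm_Ints[OF d, of 0 1] by (auto elim: Ints_cases)
  have "cnorm (map_cub of_int \<beta> :: rat cub) = of_int (392 * N)"
    unfolding \<beta> by (simp add: N cnorm_map) (simp add: \<pi>_def cnorm_def)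
  \<comment> \<open>392 is the norm of 2 \<pi>^2. Since N is an integer, the factors 2, \<pi>, \<pi>
    can be cancelled from \<beta> one at a time.\<close>
  then have n: "cnorm \<beta> = 392 * N" unfolding cnorm_map by (simp only: of_int_eq_iff)
  then obtain \<beta>1 where 1: "\<beta> = 2 * \<beta>1" using even_cnorm[of \<beta>] by auto
  then have n1: "cnorm \<beta>1 = 49 * N" using n by (simp add: cnorm_def[of 2])
  then obtain \<beta>2 where 2: "\<beta>1 = \<pi> * \<beta>2" using seven_dvd_cnorm[of \<beta>1] by (auto simp: \<pi>_def)
  then have "cnorm \<beta>2 = 7 * N" using n1 by (simp add: \<pi>_def cnorm_def[of "Cub 2 (-1) 0"])
  then obtain \<beta>3 where 3: "\<beta>2 = \<pi> * \<beta>3" using seven_dvd_cnorm[of \<beta>2] by (auto simp: \<pi>_def)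
  define e :: "rat cub" where "e = map_cub of_int (2 * \<pi> * \<pi>)"
  have "e \<noteq> 0" unfolding e_def map_cub_of_int_eq_0_iff by (simp add: \<pi>_def cub_eq_iff cub_mult)
  then obtain f where f: "e * f = 1" using rat_cub_inverse by blast
  have "e * x = e * map_cub of_int \<beta>3"
  proof -
    have "e * x = map_cub of_int \<beta>" unfolding \<beta> e_def ..
    also have "\<dots> = e * map_cub of_int \<beta>3" by (simp add: e_def 1 2 3 mult_ac)
    finally show ?thesis .
  qed
  then have "(e * f) * x = (e * f) * map_cub of_int \<beta>3" by (metis mult.assoc mult.commute)
  then show ?thesis using f by simp
qed

text \<open>Its characteristic polynomial is monic, with trace, second symmetric function and norm
  as integral coefficients up to sign.\<close>

lemma evi_algebraic_int:
  fixes t :: "'a::field_char_0"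
  assumes "is_root t"
  shows "algebraic_int (evi t x)"
proof -
  define a b c where "a = ctr x" and "b = ctr (cadj x)" and "c = cnorm x"
  have "x * x * x - of_int a * (x * x) + of_int b * x - of_int c = 0"
    unfolding a_def b_def c_def cub_ctr_int[symmetric] cub_adj_int[symmetric]
    by (simp add: cadj_eq algebra_simps)
  then have "evi t (x * x * x - of_int a * (x * x) + of_int b * x - of_int c) = 0" by simp
  then have 0: "evi t x * evi t x * evi t x - of_int a * (evi t x * evi t x) + of_int b * evi t x - of_int c = 0"
    using assms by (simp only: evi_simps evi_mult)
  define p where "p = [:- of_int c, of_int b, - of_int a, 1 :: 'a:]"
  have "poly p (evi t x) = 0" using 0 by (simp add: p_def algebra_simps)
  moreover have "lead_coeff p = 1" by (simp add: p_def)
  moreover have "\<forall>i. poly.coeff p i \<in> \<int>"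
    by (auto simp: p_def coeff_pCons split: nat.splits)
  ultimately show ?thesis by (intro algebraic_int.intros)
qed

section \<open>The number field\<close>

lemma theta_is_root:
  fixes \<zeta> :: "'a::field"
  assumes "primitive_root_of_unity 7 \<zeta>"
  shows "is_root (\<zeta> + inverse \<zeta>)"
proof -
  have z7: "\<zeta> ^ 7 = 1" and z1: "\<zeta> \<noteq> 1"
    using assms unfolding primitive_root_of_unity_def by (auto dest: spec[of _ 1])
  define i where "i = inverse \<zeta>"
  have "\<zeta> \<noteq> 0" using z7 by auto
  then have zi: "\<zeta> * i = 1" by (simp add: i_def)
  have "(\<zeta> - 1) * (\<zeta> ^ 6 + \<zeta> ^ 5 + \<zeta> ^ 4 + \<zeta> ^ 3 + \<zeta>\<^sup>2 + \<zeta> + 1) = \<zeta> ^ 7 - 1"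
    by (simp add: algebra_simps eval_nat_numeral)
  then have "\<zeta> ^ 6 + \<zeta> ^ 5 + \<zeta> ^ 4 + \<zeta> ^ 3 + \<zeta>\<^sup>2 + \<zeta> + 1 = 0" using z7 z1 by simp
  \<comment> \<open>Multiplication by \<zeta>^3 turns the cubic relation into the seventh cyclotomic
    one.\<close>
  moreover have "\<zeta> ^ 3 * ((\<zeta> + i) ^ 3 - 1 - 2 * (\<zeta> + i) + (\<zeta> + i)\<^sup>2)
    = (\<zeta> * (\<zeta> + i)) ^ 3 - \<zeta> ^ 3 - 2 * \<zeta>\<^sup>2 * (\<zeta> * (\<zeta> + i)) + \<zeta> * (\<zeta> * (\<zeta> + i))\<^sup>2"
    by (simp add: algebra_simps power2_eq_square power3_eq_cube)
  moreover have "\<zeta> * (\<zeta> + i) = \<zeta>\<^sup>2 + 1" by (simp add: distrib_left zi power2_eq_square)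
  ultimately have "\<zeta> ^ 3 * ((\<zeta> + i) ^ 3 - 1 - 2 * (\<zeta> + i) + (\<zeta> + i)\<^sup>2) = 0"
    by (simp add: algebra_simps eval_nat_numeral)
  then have "(\<zeta> + i) ^ 3 - 1 - 2 * (\<zeta> + i) + (\<zeta> + i)\<^sup>2 = 0"
    using \<open>\<zeta> \<noteq> 0\<close> by simp
  then show ?thesis unfolding is_root_def i_def by (simp add: algebra_simps)
qed

lemma exists_real_root: "\<exists>t :: real. is_root t"
proof -
  have "\<exists>t::real. 1 \<le> t \<and> t \<le> 2 \<and> t ^ 3 + t\<^sup>2 - 2 * t = 1"
    by (rule IVT') (auto intro!: continuous_intros)
  then obtain t :: real where "t ^ 3 + t\<^sup>2 - 2 * t = 1" by blast
  then have "t ^ 3 = 1 + 2 * t - t\<^sup>2" by linarith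
  then show ?thesis unfolding is_root_def by blast
qed

lemma ring_of_type_algebra_ops:
  "\<one>\<^bsub>ring_of_type_algebra\<^esub> = (1 :: complex)" "\<zero>\<^bsub>ring_of_type_algebra\<^esub> = (0 :: complex)"
  "x \<oplus>\<^bsub>ring_of_type_algebra\<^esub> y = x + (y :: complex)" "x \<otimes>\<^bsub>ring_of_type_algebra\<^esub> y = x * (y :: complex)"
  "carrier ring_of_type_algebra = (UNIV :: complex set)"
  "\<ominus>\<^bsub>ring_of_type_algebra\<^esub> x = - (x :: complex)"
  "x \<noteq> 0 \<Longrightarrow> inv\<^bsub>ring_of_type_algebra\<^esub> x = inverse (x :: complex)"
proof -
  interpret field "ring_of_type_algebra :: complex ring" by rule
  show o: "\<one>\<^bsub>ring_of_type_algebra\<^esub> = (1 :: complex)" "\<zero>\<^bsub>ring_of_type_algebra\<^esub> = (0 :: complex)"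
    "x \<oplus>\<^bsub>ring_of_type_algebra\<^esub> y = x + (y :: complex)" "x \<otimes>\<^bsub>ring_of_type_algebra\<^esub> y = x * (y :: complex)"
    "carrier ring_of_type_algebra = (UNIV :: complex set)" for x y :: complex
    by (simp_all add: ring_of_type_algebra_def)
  show "\<ominus>\<^bsub>ring_of_type_algebra\<^esub> x = - (x :: complex)"
    by (rule minus_equality) (simp_all add: o)
  show "x \<noteq> 0 \<Longrightarrow> inv\<^bsub>ring_of_type_algebra\<^esub> x = inverse (x :: complex)"
    by (rule comm_inv_char) (simp_all add: o)
qed

lemma adjoin_rat_subset:
  assumes \<theta>: "is_root \<theta>"
  shows "adjoin_rat \<theta> \<subseteq> range (evr \<theta>)"
proof
  fix x assume "x \<in> adjoin_rat \<theta>"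
  then show "x \<in> range (evr \<theta>)"
    unfolding adjoin_rat_def
  proof (induction rule: generate_field.induct)
    case one
    then show ?case using evr_simps(2)[of \<theta>] by (metis rangeI ring_of_type_algebra_ops(1))
  next
    case (incl h)
    then consider "h = \<theta>" | r where "h = of_rat r" by (auto elim: Rats_cases)
    then show ?case
    proof cases
      case 1
      have "evr \<theta> (Cub 0 1 0) = \<theta>" by (simp add: evr_def ev_def)
      then show ?thesis using 1 by (metis rangeI)
    next
      case 2
      then show ?thesis using evr_const[of \<theta> r] by (metis rangeI)
    qed
  next
    case (a_inv h)
    then show ?case by (auto simp: ring_of_type_algebra_ops intro!: rangeI simp flip: evr_simps)
  next
    case (m_inv h)
    then obtain x where x: "h = evr \<theta> x" by blast
    then have "x \<noteq> 0" using m_inv by (auto simp: ring_of_type_algebra_ops)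
    then obtain y where "x * y = 1" using rat_cub_inverse by blast
    then have "evr \<theta> (x * y) = 1" by simp
    then have "h * evr \<theta> y = 1" using x \<theta> by simp
    then have "inverse h = evr \<theta> y" by (rule inverse_unique)
    then show ?case using m_inv by (simp add: ring_of_type_algebra_ops)
  next
    case (eng_add h1 h2)
    then show ?case by (auto simp: ring_of_type_algebra_ops intro!: rangeI simp flip: evr_simps)
  next
    case (eng_mult h1 h2)
    then show ?case using \<theta> by (auto simp: ring_of_type_algebra_ops intro!: rangeI simp flip: evr_mult)
  qed
qed

lemma evi_in_adjoin_rat: "evi \<theta> x \<in> adjoin_rat \<theta>"
proof -
  have add: "u + v \<in> adjoin_rat \<theta>" if "u \<in> adjoin_rat \<theta>" "v \<in> adjoin_rat \<theta>" for u v
    using that generate_field.eng_add unfolding adjoin_rat_def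
    by (metis ring_of_type_algebra_ops(3))
  have mult: "u * v \<in> adjoin_rat \<theta>" if "u \<in> adjoin_rat \<theta>" "v \<in> adjoin_rat \<theta>" for u v
    using that generate_field.eng_mult unfolding adjoin_rat_def
    by (metis ring_of_type_algebra_ops(4))
  have "\<theta> \<in> adjoin_rat \<theta>" "of_int n \<in> adjoin_rat \<theta>" for n
    unfolding adjoin_rat_def by (auto intro: generate_field.incl)
  then show ?thesis
    unfolding evi_def ev_def power2_eq_square cub_map by (intro add mult)
qed

lemma real_embedding_exists:
  fixes t :: real
  assumes \<theta>: "is_root \<theta>" and t: "is_root t"
  obtains \<sigma> where "\<sigma> \<in> real_embeddings (adjoin_rat \<theta>)" "\<And>x. \<sigma> (evr \<theta> x) = evr t x"
proof
  \<comment> \<open>Coordinates are unique by \<open>evr_inject\<close>, so the choice is forced on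
    K; values outside K do not matter.\<close>
  define \<sigma> where "\<sigma> z = evr t (SOME x. evr \<theta> x = z)" for z
  show \<sigma>: "\<sigma> (evr \<theta> x) = evr t x" for x
  proof -
    have "(SOME y. evr \<theta> y = evr \<theta> x) = x"
      using evr_inject[OF \<theta>] by (intro some_equality) auto
    then show ?thesis by (simp add: \<sigma>_def)
  qed
  have mult: "\<sigma> (u * v) = \<sigma> u * \<sigma> v" and add: "\<sigma> (u + v) = \<sigma> u + \<sigma> v"
    if uv: "u \<in> adjoin_rat \<theta>" "v \<in> adjoin_rat \<theta>" for u v
  proof -
    obtain x y where xy: "u = evr \<theta> x" "v = evr \<theta> y" using uv adjoin_rat_subset[OF \<theta>] by blast
    then have eq: "u * v = evr \<theta> (x * y)" "u + v = evr \<theta> (x + y)" using \<theta> by simp_all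
    show "\<sigma> (u * v) = \<sigma> u * \<sigma> v" unfolding eq \<sigma> unfolding xy \<sigma> using t by simp
    show "\<sigma> (u + v) = \<sigma> u + \<sigma> v" unfolding eq \<sigma> unfolding xy \<sigma> by simp
  qed
  have "\<sigma> 1 = 1" using \<sigma>[of 1] by simp
  then show "\<sigma> \<in> real_embeddings (adjoin_rat \<theta>)"
    using mult add by (auto simp: real_embeddings_def ring_hom_def ring_of_type_algebra_def)
qed

theorem theorem18:
  fixes \<zeta> :: complex and K O_K :: "complex set"
    and Q :: "complex \<Rightarrow> complex \<Rightarrow> complex \<Rightarrow> complex \<Rightarrow> complex"
  assumes "primitive_root_of_unity 7 \<zeta>"
  defines "K \<equiv> adjoin_rat (\<zeta> + inverse \<zeta>)"
    and "O_K \<equiv> ring_of_integers K"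
    and "Q \<equiv> \<lambda>x y z w. x\<^sup>2 + y\<^sup>2 + z\<^sup>2 + w\<^sup>2 + x * y + x * z + x * w"
  shows "\<forall>\<alpha>\<in>O_K. totally_positive K \<alpha> \<longrightarrow>
           (\<exists>x\<in>O_K. \<exists>y\<in>O_K. \<exists>z\<in>O_K. \<exists>w\<in>O_K. \<alpha> = Q x y z w)"
proof (intro ballI impI)
  fix \<alpha> assume \<alpha>: "\<alpha> \<in> O_K" "totally_positive K \<alpha>"
  define \<theta> where "\<theta> = \<zeta> + inverse \<zeta>"
  have \<theta>: "is_root \<theta>" unfolding \<theta>_def using assms(1) by (rule theta_is_root)
  have K: "K = adjoin_rat \<theta>" by (simp add: K_def \<theta>_def)
  have int: "evi \<theta> x \<in> O_K" for x
    using evi_in_adjoin_rat evi_algebraic_int[OF \<theta>] by (simp add: O_K_def ring_of_integers_def K)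
  have "\<alpha> \<in> range (evr \<theta>)"
    using \<alpha>(1) adjoin_rat_subset[OF \<theta>] by (auto simp: O_K_def ring_of_integers_def K)
  then obtain x where x: "\<alpha> = evr \<theta> x" by blast
  have "algebraic_int (evr \<theta> x)" using \<alpha>(1) by (simp add: x O_K_def ring_of_integers_def)
  then obtain a where a: "x = map_cub of_int a" using integral_coordinates[OF \<theta>] by blast
  obtain t :: real where t: "is_root t" using exists_real_root by blast
  \<comment> \<open>Each real root t' gives the embedding of K that sends \<theta> to t'.\<close>
  have pos: "evi t' a > 0" if t': "is_root t'" for t' :: real
  proof -
    obtain \<sigma> where "\<sigma> \<in> real_embeddings K" "\<sigma> \<alpha> = evr t' x"
      using real_embedding_exists[OF \<theta> t'] unfolding K x by metis
    then show ?thesis using \<alpha>(2) by (auto simp: totally_positive_def a evr_of_int)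
  qed
  note r = is_root_sigma(1)[OF t] is_root_sigma(1)[OF is_root_sigma(1)[OF t]]
  have "tpos t a" using pos[OF t] pos[OF r(1)] pos[OF r(2)] t r by (simp add: tpos_def evi_csig)
  then obtain y where y: "hnorm y = a" using tpos_represented[OF t] by blast
  have "\<alpha> = evi \<theta> (hnorm y)" by (simp add: x a y evr_of_int)
  \<comment> \<open>The coefficient of (1 + i + j + k)/2 is the variable occurring in all three
    cross terms, so it comes first in \<open>Q\<close>.\<close>
  also have "\<dots> = Q (evi \<theta> (hqw y)) (evi \<theta> (hq1 y)) (evi \<theta> (hqi y)) (evi \<theta> (hqj y))"
    using \<theta> by (simp add: hnorm_def Q_def algebra_simps)
  finally show "\<exists>x\<in>O_K. \<exists>y\<in>O_K. \<exists>z\<in>O_K. \<exists>w\<in>O_K. \<alpha> = Q x y z w" using int by blast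
qed

end
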